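(* Let $A$ be a set of $n$ actions. Given a monotone Ultra reward function $f:2^A\to\mathbb{R}_{\ge 0}$ (accessed via value queries) and a Symmetric Plus Additive (SPA) cost function $c=g+p$ (with $g:2^A\to\mathbb{R}_{\ge0}$ monotone symmetric and $p:2^A\to\mathbb{R}_{\ge0}$ additive), the optimal contract, i.e. a contract $\alpha\in[0,1]$ maximizing $u_p(\alpha)=(1-\alpha)f(S_\alpha)$, can be computed in time polynomial in $n$.
   Context: $A$ is a finite set of $n$ actions. A reward function $f$ and a cost function $c$ are monotone set functions ($S\subseteq T$ implies $f(S)\le f(T)$, $c(S)\le c(T)$) with $f(\emptyset)=c(\emptyset)=0$ (in the model $f$ takes values in $[0,1]$). A contract is a number $\alpha\in[0,1]$. The agent's utility is $u_a(\alpha,S)=\alpha f(S)-c(S)$. Let $D_{f,c}(\alpha)=\operatorname{argmax}_{S\subseteq A}u_a(\alpha,S)$ and $D^*_{f,c}(\alpha)=\operatorname{argmax}_{S\in D_{f,c}(\alpha)}f(S)$. Any $S_\alpha\in D^*_{f,c}(\alpha)$ is an agent's best response; $f(S_\alpha)$ does not depend on the choice. The principal's utility is $u_p(\alpha)=(1-\alpha)f(S_\alpha)$. $p$ is additive if $p(S)=\sum_{a\in S}p(\{a\})$; $g$ is symmetric if $g(S)=g(T)$ whenever $|S|=|T|$. $c$ is SPA if $c=g+p$ with $g$ monotone symmetric and $p$ additive; the components $g,p$ are given. A value query returns $f(S)$ for a given $S\subseteq A$. Polynomial time means that the number of value queries and elementary arithmetic operations/comparisons on reals is bounded by a polynomial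 in $n$. Ultra: $f$ is Ultra if it satisfies the exchange property: for all $S,T\subseteq A$ with $|S|\le|T|$ and every $x\in S\setminus T$ there is $y\in T\setminus S$ with $f(S)+f(T)\le f((S\setminus\{x\})\cup\{y\})+f((T\setminus\{y\})\cup\{x\})$. It is known that this is equivalent to the well-layered property: for every price vector $q\in\mathbb{R}^n_{\ge0}$ and every sequence $S_0=\emptyset$, $S_i=S_{i-1}\cup\{x_i\}$ with $x_i\in\operatorname{argmax}_{x\notin S_{i-1}}\{f(S_{i-1}\cup\{x\})-f(S_{i-1})-q_x\}$ (ties broken arbitrarily), one has $S_i\in\operatorname{argmax}_{|S|=i}\{f(S)-\sum_{x\in S}q_x\}$ for every $i\in[n]$. *)

theory Defs
  imports Complex_Main "HOL-Computational_Algebra.Polynomial"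
begin

section \<open>Contracts\<close>

text \<open>A set function on \<open>2\<^sup>A\<close> is represented by a function on all sets whose values outside
  \<open>Pow A\<close> are irrelevant; every notion below only looks at subsets of \<open>A\<close>.\<close>

definition nonneg_set_fun :: "'a set \<Rightarrow> ('a set \<Rightarrow> real) \<Rightarrow> bool" where
  "nonneg_set_fun A f \<longleftrightarrow> (\<forall>S\<subseteq>A. 0 \<le> f S)"

definition monotone_normalized :: "'a set \<Rightarrow> ('a set \<Rightarrow> real) \<Rightarrow> bool" where
  "monotone_normalized A f \<longleftrightarrow> mono_on (Pow A) f \<and> f {} = 0"

definition additive_set_fun :: "'a set \<Rightarrow> ('a set \<Rightarrow> real) \<Rightarrow> bool" where
  "additive_set_fun A p \<longleftrightarrow> (\<forall>S\<subseteq>A. p S = (\<Sum>a\<in>S. p {a}))"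

definition symmetric_set_fun :: "'a set \<Rightarrow> ('a set \<Rightarrow> real) \<Rightarrow> bool" where
  "symmetric_set_fun A g \<longleftrightarrow> (\<forall>S\<subseteq>A. \<forall>T\<subseteq>A. card S = card T \<longrightarrow> g S = g T)"

definition ultra :: "'a set \<Rightarrow> ('a set \<Rightarrow> real) \<Rightarrow> bool" where
  "ultra A f \<longleftrightarrow>
     (\<forall>S\<subseteq>A. \<forall>T\<subseteq>A. card S \<le> card T \<longrightarrow>
        (\<forall>x\<in>S - T. \<exists>y\<in>T - S.
           f S + f T \<le> f ((S - {x}) \<union> {y}) + f ((T - {y}) \<union> {x})))"

definition agent_utility :: "('a set \<Rightarrow> real) \<Rightarrow> ('a set \<Rightarrow> real) \<Rightarrow> real \<Rightarrow> 'a set \<Rightarrow> real" where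
  "agent_utility f c \<alpha> S = \<alpha> * f S - c S"

definition agent_demand ::
  "'a set \<Rightarrow> ('a set \<Rightarrow> real) \<Rightarrow> ('a set \<Rightarrow> real) \<Rightarrow> real \<Rightarrow> 'a set set" where
  "agent_demand A f c \<alpha> = {S. is_arg_max (agent_utility f c \<alpha>) (\<lambda>S. S \<subseteq> A) S}"

definition best_responses ::
  "'a set \<Rightarrow> ('a set \<Rightarrow> real) \<Rightarrow> ('a set \<Rightarrow> real) \<Rightarrow> real \<Rightarrow> 'a set set" where
  "best_responses A f c \<alpha> = {S. is_arg_max f (\<lambda>S. S \<in> agent_demand A f c \<alpha>) S}"

text \<open>The choice of the best response is immaterial, see \<open>principal_utility_eq\<close> below.\<close>

definition principal_utility ::
  "'a set \<Rightarrow> ('a set \<Rightarrow> real) \<Rightarrow> ('a set \<Rightarrow> real) \<Rightarrow> real \<Rightarrow> real" where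
  "principal_utility A f c \<alpha> = (1 - \<alpha>) * f (SOME S. S \<in> best_responses A f c \<alpha>)"

definition optimal_contract ::
  "'a set \<Rightarrow> ('a set \<Rightarrow> real) \<Rightarrow> ('a set \<Rightarrow> real) \<Rightarrow> real \<Rightarrow> bool" where
  "optimal_contract A f c \<alpha> \<longleftrightarrow> is_arg_max (principal_utility A f c) (\<lambda>\<alpha>. 0 \<le> \<alpha> \<and> \<alpha> \<le> 1) \<alpha>"

lemma finite_is_arg_max_ex:
  fixes h :: "'b \<Rightarrow> real"
  assumes "finite {x. P x}" "\<exists>x. P x"
  shows "\<exists>x. is_arg_max h P x"
proof -
  let ?M = "Max (h ` {x. P x})"
  have "?M \<in> h ` {x. P x}" using assms by (intro Max_in) auto
  then obtain x where "P x" "h x = ?M" by auto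
  moreover have "h y \<le> ?M" if "P y" for y using assms that by (intro Max_ge) auto
  ultimately show ?thesis by (auto simp: is_arg_max_linorder)
qed

lemma best_responses_nonempty:
  assumes "finite A"
  shows "best_responses A f c \<alpha> \<noteq> {}"
proof -
  have "finite {S. S \<subseteq> A}" using assms by simp
  then have "agent_demand A f c \<alpha> \<noteq> {}"
    using finite_is_arg_max_ex[of "\<lambda>S. S \<subseteq> A" "agent_utility f c \<alpha>"]
    by (auto simp: agent_demand_def)
  moreover have "finite (agent_demand A f c \<alpha>)"
    by (rule finite_subset[of _ "Pow A"])
      (use assms in \<open>auto simp: agent_demand_def is_arg_max_def\<close>)
  ultimately show ?thesis
    using finite_is_arg_max_ex[of "\<lambda>S. S \<in> agent_demand A f c \<alpha>" f]
    by (auto simp: best_responses_def)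
qed

lemma principal_utility_eq:
  assumes "S \<in> best_responses A f c \<alpha>"
  shows "principal_utility A f c \<alpha> = (1 - \<alpha>) * f S"
proof -
  let ?T = "SOME S. S \<in> best_responses A f c \<alpha>"
  have "?T \<in> best_responses A f c \<alpha>" using assms by (rule someI)
  then have "f ?T = f S" using assms
    by (auto simp: best_responses_def is_arg_max_linorder intro: order_antisym)
  then show ?thesis by (simp add: principal_utility_def)
qed


section \<open>A real RAM with value queries\<close>

text \<open>A uniform model of computation: one program serves all \<open>n\<close>. Memory consists of arrays
  of natural numbers (for indices, counters and sets) and arrays of reals, both addressed by a
  name and a computed index. Natural numbers only have addition and truncated subtraction, so
  unit cost is harmless for them. Reals can only be produced from \<open>0\<close> and \<open>1\<close> by the four
  field operations and from value queries, and can only be inspected by \<open>RLess\<close>; there is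
  no rounding. Division by zero yields \<open>0\<close>, as always in HOL.\<close>

datatype nexp = Num nat | NCell nat nexp | NAdd nexp nexp | NSub nexp nexp

datatype rexp = RZero | ROne | RCell nat nexp
  | RAdd rexp rexp | RSub rexp rexp | RMul rexp rexp | RDiv rexp rexp

datatype bexp = NLess nexp nexp | RLess rexp rexp | BNot bexp | BAnd bexp bexp

datatype input_fun = Reward | SymCost | AddCost

text \<open>\<open>Query q x i b\<close> writes to the real cell \<open>x[i]\<close> the value of the input function \<open>q\<close>
  on the set of actions whose characteristic vector is held by the array \<open>b\<close>.\<close>

datatype com = Skip
  | NAssign nat nexp nexp
  | RAssign nat nexp rexp
  | Query input_fun nat nexp nat
  | Seq com com
  | Cond bexp com com
  | While bexp com

record state =
  nats :: "nat \<Rightarrow> nat \<Rightarrow> nat"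
  reals :: "nat \<Rightarrow> nat \<Rightarrow> real"

definition write_cell :: "(nat \<Rightarrow> nat \<Rightarrow> 'v) \<Rightarrow> nat \<Rightarrow> nat \<Rightarrow> 'v \<Rightarrow> nat \<Rightarrow> nat \<Rightarrow> 'v" where
  "write_cell m x i v = m(x := (m x)(i := v))"

primrec nval :: "nexp \<Rightarrow> state \<Rightarrow> nat" where
  "nval (Num k) s = k"
| "nval (NCell x e) s = nats s x (nval e s)"
| "nval (NAdd a b) s = nval a s + nval b s"
| "nval (NSub a b) s = nval a s - nval b s"

primrec rval :: "rexp \<Rightarrow> state \<Rightarrow> real" where
  "rval RZero s = 0"
| "rval ROne s = 1"
| "rval (RCell x e) s = reals s x (nval e s)"
| "rval (RAdd a b) s = rval a s + rval b s"
| "rval (RSub a b) s = rval a s - rval b s"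
| "rval (RMul a b) s = rval a s * rval b s"
| "rval (RDiv a b) s = rval a s / rval b s"

primrec bval :: "bexp \<Rightarrow> state \<Rightarrow> bool" where
  "bval (NLess a b) s \<longleftrightarrow> nval a s < nval b s"
| "bval (RLess a b) s \<longleftrightarrow> rval a s < rval b s"
| "bval (BNot b) s \<longleftrightarrow> \<not> bval b s"
| "bval (BAnd a b) s \<longleftrightarrow> bval a s \<and> bval b s"

text \<open>Evaluating an expression costs one step per constant, memory access, operation and
  comparison.\<close>

primrec ncost :: "nexp \<Rightarrow> nat" where
  "ncost (Num k) = 1"
| "ncost (NCell x e) = 1 + ncost e"
| "ncost (NAdd a b) = 1 + ncost a + ncost b"
| "ncost (NSub a b) = 1 + ncost a + ncost b"

primrec rcost :: "rexp \<Rightarrow> nat" where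
  "rcost RZero = 1"
| "rcost ROne = 1"
| "rcost (RCell x e) = 1 + ncost e"
| "rcost (RAdd a b) = 1 + rcost a + rcost b"
| "rcost (RSub a b) = 1 + rcost a + rcost b"
| "rcost (RMul a b) = 1 + rcost a + rcost b"
| "rcost (RDiv a b) = 1 + rcost a + rcost b"

primrec bcost :: "bexp \<Rightarrow> nat" where
  "bcost (NLess a b) = 1 + ncost a + ncost b"
| "bcost (RLess a b) = 1 + rcost a + rcost b"
| "bcost (BNot b) = 1 + bcost b"
| "bcost (BAnd a b) = 1 + bcost a + bcost b"

definition held_set :: "nat \<Rightarrow> nat \<Rightarrow> state \<Rightarrow> nat set" where
  "held_set n b s = {i. i < n \<and> nats s b i \<noteq> 0}"

text \<open>\<open>exec n orc c s t s'\<close>: started in \<open>s\<close>, the program \<open>c\<close> terminates after exactly \<open>t\<close>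
  steps in \<open>s'\<close>. The parameters \<open>n\<close> and \<open>orc\<close> are used by queries only.\<close>

inductive exec ::
  "nat \<Rightarrow> (input_fun \<Rightarrow> nat set \<Rightarrow> real) \<Rightarrow> com \<Rightarrow> state \<Rightarrow> nat \<Rightarrow> state \<Rightarrow> bool"
  for n orc where
  Skip: "exec n orc Skip s 1 s"
| NAssign: "exec n orc (NAssign x i e) s (1 + ncost i + ncost e)
     (s\<lparr>nats := write_cell (nats s) x (nval i s) (nval e s)\<rparr>)"
| RAssign: "exec n orc (RAssign x i e) s (1 + ncost i + rcost e)
     (s\<lparr>reals := write_cell (reals s) x (nval i s) (rval e s)\<rparr>)"
| Query: "exec n orc (Query q x i b) s (1 + ncost i)
     (s\<lparr>reals := write_cell (reals s) x (nval i s) (orc q (held_set n b s))\<rparr>)"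
| Seq: "exec n orc c1 s t1 s1 \<Longrightarrow> exec n orc c2 s1 t2 s2 \<Longrightarrow>
     exec n orc (Seq c1 c2) s (t1 + t2) s2"
| CondTrue: "bval b s \<Longrightarrow> exec n orc c1 s t s' \<Longrightarrow>
     exec n orc (Cond b c1 c2) s (1 + bcost b + t) s'"
| CondFalse: "\<not> bval b s \<Longrightarrow> exec n orc c2 s t s' \<Longrightarrow>
     exec n orc (Cond b c1 c2) s (1 + bcost b + t) s'"
| WhileFalse: "\<not> bval b s \<Longrightarrow> exec n orc (While b c) s (1 + bcost b) s"
| WhileTrue: "bval b s \<Longrightarrow> exec n orc c s t1 s1 \<Longrightarrow> exec n orc (While b c) s1 t2 s2 \<Longrightarrow>
     exec n orc (While b c) s (1 + bcost b + t1 + t2) s2"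

inductive_cases SkipE: "exec n orc Skip s t s'"
inductive_cases NAssignE: "exec n orc (NAssign x i e) s t s'"
inductive_cases RAssignE: "exec n orc (RAssign x i e) s t s'"
inductive_cases QueryE: "exec n orc (Query q x i b) s t s'"
inductive_cases SeqE: "exec n orc (Seq c1 c2) s t s'"
inductive_cases CondE: "exec n orc (Cond b c1 c2) s t s'"
inductive_cases WhileE: "exec n orc (While b c) s t s'"

lemma exec_deterministic:
  assumes "exec n orc c s t s'" "exec n orc c s u s''"
  shows "u = t \<and> s'' = s'"
  using assms
proof (induction arbitrary: u s'' rule: exec.induct)
  case (Skip s)
  then show ?case by (rule SkipE) simp
next
  case (NAssign x i e s)
  then show ?case by (rule NAssignE) simp
next
  case (RAssign x i e s)
  then show ?case by (rule RAssignE) simp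
next
  case (Query q x i b s)
  then show ?case by (rule QueryE) simp
next
  case (Seq c1 s t1 s1 c2 t2 s2)
  obtain t1' s1' t2' where "exec n orc c1 s t1' s1'" "exec n orc c2 s1' t2' s''" "u = t1' + t2'"
    using Seq.prems by (rule SeqE)
  with Seq.IH(1)[of t1' s1'] Seq.IH(2)[of t2' s''] show ?case by simp
next
  case (CondTrue b s c1 t s' c2)
  obtain t' where "exec n orc c1 s t' s''" "u = 1 + bcost b + t'"
    using CondTrue.prems by (rule CondE) (use CondTrue.hyps in simp_all)
  with CondTrue.IH[of t' s''] show ?case by simp
next
  case (CondFalse b s c2 t s' c1)
  obtain t' where "exec n orc c2 s t' s''" "u = 1 + bcost b + t'"
    using CondFalse.prems by (rule CondE) (use CondFalse.hyps in simp_all)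
  with CondFalse.IH[of t' s''] show ?case by simp
next
  case (WhileFalse b s c)
  show ?case using WhileFalse.prems by (rule WhileE) (use WhileFalse.hyps in simp_all)
next
  case (WhileTrue b s c t1 s1 t2 s2)
  obtain t1' s1' t2' where "exec n orc c s t1' s1'" "exec n orc (While b c) s1' t2' s''"
      "u = 1 + bcost b + t1' + t2'"
    using WhileTrue.prems by (rule WhileE) (use WhileTrue.hyps in simp_all)
  with WhileTrue.IH(1)[of t1' s1'] WhileTrue.IH(2)[of t2' s''] show ?case by simp
qed

text \<open>The only input visible in memory is \<open>n\<close>, in cell \<open>0\<close> of the natural-number array \<open>0\<close>;
  the reward and the two components of the cost are accessible through queries only.
  The result is delivered in cell \<open>0\<close> of the real array \<open>0\<close>.\<close>

definition initial_state :: "nat \<Rightarrow> state" where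
  "initial_state n = \<lparr>nats = write_cell (\<lambda>_ _. 0) 0 0 n, reals = (\<lambda>_ _. 0)\<rparr>"

definition result :: "state \<Rightarrow> real" where
  "result s = reals s 0 0"

primrec input_oracle ::
  "(nat set \<Rightarrow> real) \<Rightarrow> (nat set \<Rightarrow> real) \<Rightarrow> (nat set \<Rightarrow> real) \<Rightarrow> input_fun \<Rightarrow> nat set \<Rightarrow> real" where
  "input_oracle f g p Reward = f"
| "input_oracle f g p SymCost = g"
| "input_oracle f g p AddCost = p"

end

theory Submission
  imports Defs
begin

text \<open>The exchange property of \<open>f\<close> survives scaling and subtracting the additive cost. On a
  fixed layer, the sets of a given size, where the symmetric cost is constant, it makes local
  optima under single swaps global; between layers it makes the greedy extension of an optimal
  set optimal. At the contract \<open>1\<close> the optimum of every layer is thus found greedily. Decreasing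
  the contract, the optimum of a layer can only be overtaken by a swap \<open>x \<mapsto> y\<close> that lowers both
  the reward and the additive cost, so \<open>p {y} < p {x}\<close>; the sum of the ranks of the elements with
  respect to \<open>p\<close> decreases, and a layer has at most \<open>n\<^sup>2\<close> breakpoints. The polynomially many
  optima met in this way represent all best responses, and an optimal contract is found among the
  breakpoints of the upper envelope of their lines \<open>\<alpha> \<mapsto> \<alpha> f S - c S\<close>.\<close>


section \<open>Counting loops with uniformly bounded running time\<close>

abbreviation seq_infix :: "com \<Rightarrow> com \<Rightarrow> com" (infixr ";;" 60) where
  "c1 ;; c2 \<equiv> Seq c1 c2"

abbreviation ncell :: "nat \<Rightarrow> nexp" where
  "ncell x \<equiv> NCell x (Num 0)"

abbreviation rcell :: "nat \<Rightarrow> rexp" where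
  "rcell x \<equiv> RCell x (Num 0)"

abbreviation set_nat :: "nat \<Rightarrow> nexp \<Rightarrow> com" where
  "set_nat x e \<equiv> NAssign x (Num 0) e"

abbreviation set_real :: "nat \<Rightarrow> rexp \<Rightarrow> com" where
  "set_real x e \<equiv> RAssign x (Num 0) e"

text \<open>The bound is evaluated anew before every round; \<open>runs_For\<close> therefore
  requires that the body leave the arrays occurring in it alone.\<close>

definition For :: "nat \<Rightarrow> nexp \<Rightarrow> com \<Rightarrow> com" where
  "For x b c = set_nat x (Num 0) ;;
     While (NLess (ncell x) b) (c ;; set_nat x (NAdd (ncell x) (Num 1)))"

text \<open>\<open>M\<close> bounds the number of iterations of each single loop. Syntactically the bound is a
  polynomial in \<open>M\<close>, so no running time has to be computed by hand.\<close>

primrec time_bound :: "nat \<Rightarrow> com \<Rightarrow> nat" where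
  "time_bound M Skip = 1"
| "time_bound M (NAssign x i e) = 1 + ncost i + ncost e"
| "time_bound M (RAssign x i e) = 1 + ncost i + rcost e"
| "time_bound M (Query q x i b) = 1 + ncost i"
| "time_bound M (Seq c1 c2) = time_bound M c1 + time_bound M c2"
| "time_bound M (Cond b c1 c2) = 1 + bcost b + time_bound M c1 + time_bound M c2"
| "time_bound M (While b c) = 1 + bcost b + M * (1 + bcost b + time_bound M c)"

text \<open>A loop contributes the factor \<open>[:0, 1:]\<close>, the variable that stands for
  \<open>M\<close>; the costs of expressions are constants fixed by the syntax.\<close>

lemma time_bound_poly: "\<exists>P :: nat poly. \<forall>M. time_bound M c = poly P M"
proof -
  have const: "\<exists>P :: nat poly. \<forall>M. k = poly P M" for k :: nat
    by (rule exI[of _ "[:k:]"]) simp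
  show ?thesis
  proof (induction c)
    case (Seq c1 c2)
    then obtain P1 P2 :: "nat poly" where "\<forall>M. time_bound M c1 = poly P1 M" "\<forall>M. time_bound M c2 = poly P2 M"
      by blast
    then show ?case by (intro exI[of _ "P1 + P2"]) simp
  next
    case (Cond b c1 c2)
    then obtain P1 P2 :: "nat poly" where "\<forall>M. time_bound M c1 = poly P1 M" "\<forall>M. time_bound M c2 = poly P2 M"
      by blast
    then show ?case by (intro exI[of _ "[:1 + bcost b:] + P1 + P2"]) simp
  next
    case (While b c)
    then obtain P :: "nat poly" where "\<forall>M. time_bound M c = poly P M" by blast
    then show ?case by (intro exI[of _ "[:1 + bcost b:] + [:0, 1:] * ([:1 + bcost b:] + P)"]) simp
  qed (simp_all only: time_bound.simps const)
qed

section \<open>Frame conditions at the granularity of whole arrays\<close>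

primrec narrays :: "nexp \<Rightarrow> nat set" where
  "narrays (Num k) = {}"
| "narrays (NCell x e) = insert x (narrays e)"
| "narrays (NAdd a b) = narrays a \<union> narrays b"
| "narrays (NSub a b) = narrays a \<union> narrays b"

lemma nval_cong: "(\<And>v. v \<in> narrays e \<Longrightarrow> nats s v = nats s' v) \<Longrightarrow> nval e s = nval e s'"
  by (induction e) auto

primrec nmods :: "com \<Rightarrow> nat set" where
  "nmods Skip = {}"
| "nmods (NAssign x i e) = {x}"
| "nmods (RAssign x i e) = {}"
| "nmods (Query q x i b) = {}"
| "nmods (Seq c1 c2) = nmods c1 \<union> nmods c2"
| "nmods (Cond b c1 c2) = nmods c1 \<union> nmods c2"
| "nmods (While b c) = nmods c"

primrec rmods :: "com \<Rightarrow> nat set" where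
  "rmods Skip = {}"
| "rmods (NAssign x i e) = {}"
| "rmods (RAssign x i e) = {x}"
| "rmods (Query q x i b) = {x}"
| "rmods (Seq c1 c2) = rmods c1 \<union> rmods c2"
| "rmods (Cond b c1 c2) = rmods c1 \<union> rmods c2"
| "rmods (While b c) = rmods c"

lemma nmods_For [simp]: "nmods (For x b c) = insert x (nmods c)"
  by (auto simp: For_def)

lemma rmods_For [simp]: "rmods (For x b c) = rmods c"
  by (auto simp: For_def)

definition frame :: "com \<Rightarrow> state \<Rightarrow> state \<Rightarrow> bool" where
  "frame c s s' \<longleftrightarrow> (\<forall>v. v \<notin> nmods c \<longrightarrow> nats s' v = nats s v) \<and> (\<forall>v. v \<notin> rmods c \<longrightarrow> reals s' v = reals s v)"

lemma exec_frame: "exec n orc c s t s' \<Longrightarrow> frame c s s'"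
  by (induction rule: exec.induct) (auto simp: frame_def write_cell_def)

text \<open>Total correctness and the time bound in one predicate: deriving a postcondition by the
  rules below yields the running time as a by-product.\<close>

definition runs ::
  "nat \<Rightarrow> (input_fun \<Rightarrow> nat set \<Rightarrow> real) \<Rightarrow> nat \<Rightarrow> com \<Rightarrow> state \<Rightarrow> (state \<Rightarrow> bool) \<Rightarrow> bool" where
  "runs n orc M c s Q \<longleftrightarrow> (\<exists>t s'. exec n orc c s t s' \<and> t \<le> time_bound M c \<and> Q s')"

text \<open>The frame of the executed command is available in the weakening, so postconditions need
  not list what stays unchanged.\<close>

lemma runs_conseq:
  assumes "runs n orc M c s Q" "\<And>s'. Q s' \<Longrightarrow> frame c s s' \<Longrightarrow> Q' s'"
  shows "runs n orc M c s Q'"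
  using assms exec_frame unfolding runs_def by blast

lemma runs_Skip: "Q s \<Longrightarrow> runs n orc M Skip s Q"
  unfolding runs_def using exec.Skip by fastforce

lemma runs_NAssign:
  "Q (s\<lparr>nats := write_cell (nats s) x (nval i s) (nval e s)\<rparr>) \<Longrightarrow> runs n orc M (NAssign x i e) s Q"
  unfolding runs_def using exec.NAssign by fastforce

lemma runs_RAssign:
  "Q (s\<lparr>reals := write_cell (reals s) x (nval i s) (rval e s)\<rparr>) \<Longrightarrow> runs n orc M (RAssign x i e) s Q"
  unfolding runs_def using exec.RAssign by fastforce

lemma runs_Query:
  "Q (s\<lparr>reals := write_cell (reals s) x (nval i s) (orc q (held_set n b s))\<rparr>) \<Longrightarrow>
   runs n orc M (Query q x i b) s Q"
  unfolding runs_def using exec.Query by fastforce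

lemma runs_Seq: "runs n orc M c1 s (\<lambda>s'. runs n orc M c2 s' Q) \<Longrightarrow> runs n orc M (c1 ;; c2) s Q"
  unfolding runs_def time_bound.simps by (meson add_mono exec.Seq)

lemma runs_Cond:
  assumes "bval b s \<Longrightarrow> runs n orc M c1 s Q" "\<not> bval b s \<Longrightarrow> runs n orc M c2 s Q"
  shows "runs n orc M (Cond b c1 c2) s Q"
proof (cases "bval b s")
  case True
  with assms(1) obtain t s' where "exec n orc c1 s t s'" "t \<le> time_bound M c1" "Q s'"
    by (auto simp: runs_def)
  with exec.CondTrue[OF True] show ?thesis by (fastforce simp: runs_def)
next
  case False
  with assms(2) obtain t s' where "exec n orc c2 s t s'" "t \<le> time_bound M c2" "Q s'"
    by (auto simp: runs_def)
  with exec.CondFalse[OF False] show ?thesis by (fastforce simp: runs_def)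
qed

lemmas runs_intros = runs_Skip runs_NAssign runs_RAssign runs_Query runs_Seq runs_Cond

text \<open>The index of the invariant counts the rounds done and alone decides the guard: true
  below \<open>N\<close>, false at \<open>N\<close>. The induction is on the rounds left.\<close>

lemma exec_While_count:
  assumes "j \<le> N" "J j s"
    and "\<And>k s. k < N \<Longrightarrow> J k s \<Longrightarrow> bval b s \<and> (\<exists>t s'. exec n orc c s t s' \<and> t \<le> T \<and> J (Suc k) s')"
    and "\<And>s. J N s \<Longrightarrow> \<not> bval b s"
  shows "\<exists>t s'. exec n orc (While b c) s t s' \<and> t \<le> 1 + bcost b + (N - j) * (1 + bcost b + T) \<and> J N s'"
  using assms(1,2)
proof (induction "N - j" arbitrary: j s)
  case 0
  then have "j = N" by simp
  with 0 assms(4) show ?case using exec.WhileFalse by fastforce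
next
  case (Suc m)
  then have "j < N" "m = N - Suc j" by auto
  from assms(3)[OF \<open>j < N\<close> Suc.prems(2)] obtain t1 s1
    where 1: "bval b s" "exec n orc c s t1 s1" "t1 \<le> T" "J (Suc j) s1" by blast
  from Suc.hyps(1)[OF \<open>m = N - Suc j\<close> _ 1(4)] \<open>j < N\<close> obtain t2 s2
    where 2: "exec n orc (While b c) s1 t2 s2"
      "t2 \<le> 1 + bcost b + (N - Suc j) * (1 + bcost b + T)" "J N s2" by auto
  have "N - j = Suc (N - Suc j)" using \<open>j < N\<close> by simp
  then have "1 + bcost b + t1 + t2 \<le> 1 + bcost b + (N - j) * (1 + bcost b + T)"
    using 1(3) 2(2) by simp
  with exec.WhileTrue[OF 1(1,2) 2(1)] 2(3) show ?case by blast
qed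

text \<open>Every round sees the frame of the whole loop relative to the initial state, so an
  invariant need only speak of what the loop changes.\<close>

lemma runs_For:
  assumes bound: "nval b s \<le> M"
    and fresh: "x \<notin> nmods c" "narrays b \<inter> insert x (nmods c) = {}"
    and init: "I 0 (s\<lparr>nats := write_cell (nats s) x 0 0\<rparr>)"
    and step: "\<And>k s'. k < nval b s \<Longrightarrow> I k s' \<Longrightarrow> nats s' x 0 = k \<Longrightarrow> frame (For x b c) s s' \<Longrightarrow>
      runs n orc M c s' (\<lambda>s''. I (Suc k) (s''\<lparr>nats := write_cell (nats s'') x 0 (Suc k)\<rparr>))"
    and final: "\<And>s'. I (nval b s) s' \<Longrightarrow> frame (For x b c) s s' \<Longrightarrow> Q s'"
  shows "runs n orc M (For x b c) s Q"
proof -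
  let ?N = "nval b s" and ?b = "NLess (ncell x) b"
  let ?inc = "set_nat x (NAdd (ncell x) (Num 1))"
  let ?J = "\<lambda>k s'. I k s' \<and> nats s' x 0 = k \<and> frame (For x b c) s s'"
  let ?s0 = "s\<lparr>nats := write_cell (nats s) x 0 0\<rparr>"
  have b: "nval b s' = ?N" if "frame (For x b c) s s'" for s'
    using that fresh by (intro nval_cong) (auto simp: frame_def)
  have "\<exists>t s'. exec n orc (While ?b (c ;; ?inc)) ?s0 t s' \<and>
      t \<le> 1 + bcost ?b + (?N - 0) * (1 + bcost ?b + time_bound M (c ;; ?inc)) \<and> ?J ?N s'"
  proof (rule exec_While_count[where J = ?J and j = 0])
    show "?J 0 ?s0" using init by (simp add: frame_def write_cell_def)
    fix k s' assume k: "k < ?N" and J: "?J k s'"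
    then have "runs n orc M c s' (\<lambda>s''. I (Suc k) (s''\<lparr>nats := write_cell (nats s'') x 0 (Suc k)\<rparr>))"
      using step by blast
    then obtain t s2 where 2: "exec n orc c s' t s2" "t \<le> time_bound M c"
        "I (Suc k) (s2\<lparr>nats := write_cell (nats s2) x 0 (Suc k)\<rparr>)"
      by (auto simp: runs_def)
    have x: "nats s2 x = nats s' x" using exec_frame[OF 2(1)] fresh by (auto simp: frame_def)
    \<comment> \<open>The increment costs 1 for the assignment, 1 for the index and 4 for the
      sum.\<close>
    have inc: "exec n orc ?inc s2 6 (s2\<lparr>nats := write_cell (nats s2) x 0 (Suc k)\<rparr>)"
      using exec.NAssign[of n orc x "Num 0" "NAdd (ncell x) (Num 1)" s2] x J
      by (simp add: numeral_eq_Suc)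
    have fr: "frame (For x b c) s (s2\<lparr>nats := write_cell (nats s2) x 0 (Suc k)\<rparr>)"
      using exec_frame[OF 2(1)] J by (auto simp: frame_def write_cell_def)
    show "bval ?b s' \<and> (\<exists>t s''. exec n orc (c ;; ?inc) s' t s'' \<and>
        t \<le> time_bound M (c ;; ?inc) \<and> ?J (Suc k) s'')"
      using exec.Seq[OF 2(1) inc] 2 fr k J b[of s']
      by (intro conjI exI[of _ "t + 6"] exI[of _ "s2\<lparr>nats := write_cell (nats s2) x 0 (Suc k)\<rparr>"])
        (auto simp: write_cell_def)
  next
    fix s' assume "?J ?N s'"
    then show "\<not> bval ?b s'" using b[of s'] by simp
  qed simp
  then obtain t s' where t: "exec n orc (While ?b (c ;; ?inc)) ?s0 t s'"
      "t \<le> 1 + bcost ?b + ?N * (1 + bcost ?b + time_bound M (c ;; ?inc))" "?J ?N s'" by auto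
  have "?N * (1 + bcost ?b + time_bound M (c ;; ?inc)) \<le> M * (1 + bcost ?b + time_bound M (c ;; ?inc))"
    using bound by (rule mult_le_mono1)
  then have le: "t \<le> time_bound M (While ?b (c ;; ?inc))" using t(2)
    unfolding time_bound.simps by linarith
  have "exec n orc (set_nat x (Num 0)) s (1 + 1 + 1) ?s0"
    using exec.NAssign[of n orc x "Num 0" "Num 0" s] by simp
  from exec.Seq[OF this t(1)] have ex: "exec n orc (For x b c) s (1 + 1 + 1 + t) s'"
    by (simp add: For_def)
  have "1 + 1 + 1 + t \<le> time_bound M (For x b c)"
    using le unfolding For_def time_bound.simps(2,5) ncost.simps by linarith
  with ex final t(3) show ?thesis by (auto simp: runs_def)
qed


section \<open>Exchange arguments on layers\<close>

definition layer_optimal :: "'a set \<Rightarrow> ('a set \<Rightarrow> real) \<Rightarrow> 'a set \<Rightarrow> bool" where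
  "layer_optimal A h S \<longleftrightarrow> S \<subseteq> A \<and> (\<forall>T\<subseteq>A. card T = card S \<longrightarrow> h T \<le> h S)"

section \<open>Exchange property and optima of layers\<close>

lemma ultraE:
  assumes "ultra A h" "S \<subseteq> A" "T \<subseteq> A" "card S \<le> card T" "x \<in> S - T"
  obtains y where "y \<in> T - S" "h S + h T \<le> h (insert y (S - {x})) + h (insert x (T - {y}))"
proof -
  have "\<exists>y\<in>T - S. h S + h T \<le> h (S - {x} \<union> {y}) + h (T - {y} \<union> {x})"
    using assms unfolding ultra_def by blast
  then show thesis using that by auto
qed

lemma card_swap:
  assumes "finite S" "x \<in> S" "y \<notin> S"
  shows "card (insert y (S - {x})) = card S"
  using assms by (metis card_insert_disjoint card_Suc_Diff1 finite_Diff DiffD1)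

lemma sum_swap:
  fixes w :: "'a \<Rightarrow> 'b :: ab_group_add"
  assumes "finite S" "x \<in> S" "y \<notin> S"
  shows "sum w (insert y (S - {x})) = sum w S - w x + w y"
  using assms by (simp add: sum_diff1)

lemma additive_swap:
  assumes "additive_set_fun A p" "finite A" "S \<subseteq> A" "x \<in> S" "y \<in> A - S"
  shows "p (insert y (S - {x})) = p S - p {x} + p {y}"
proof -
  have "finite S" using assms finite_subset by blast
  have sums: "p T = (\<Sum>a\<in>T. p {a})" if "T \<subseteq> A" for T
    using assms(1) that by (simp only: additive_set_fun_def)
  have "insert y (S - {x}) \<subseteq> A" using assms by auto
  then show ?thesis
    using sums[of "insert y (S - {x})"] sums[OF assms(3)] sum_swap[of S x y "\<lambda>a. p {a}"] \<open>finite S\<close> assms(4,5)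
    by simp
qed

text \<open>An exchange moves \<open>x\<close> and \<open>y\<close> between the two sets, so the sum
  of their additive costs does not change; the factor \<open>\<beta>\<close> is nonnegative and
  keeps the inequality.\<close>

lemma ultra_priced:
  assumes "ultra A f" "additive_set_fun A p" "finite A" "0 \<le> \<beta>"
  shows "ultra A (\<lambda>S. \<beta> * f S - p S)"
  unfolding ultra_def
proof (intro allI impI ballI)
  fix S T x assume S: "S \<subseteq> A" "T \<subseteq> A" "card S \<le> card T" and x: "x \<in> S - T"
  from ultraE[OF assms(1) S x] obtain y where y: "y \<in> T - S"
    "f S + f T \<le> f (insert y (S - {x})) + f (insert x (T - {y}))" .
  have "\<beta> * (f S + f T) \<le> \<beta> * (f (insert y (S - {x})) + f (insert x (T - {y})))"
    using y(2) assms(4) by (rule mult_left_mono)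
  moreover have "p (insert y (S - {x})) = p S - p {x} + p {y}"
    "p (insert x (T - {y})) = p T - p {y} + p {x}"
    using additive_swap[OF assms(2,3)] S x y(1) by auto
  ultimately show "\<exists>y\<in>T - S. \<beta> * f S - p S + (\<beta> * f T - p T)
      \<le> \<beta> * f (S - {x} \<union> {y}) - p (S - {x} \<union> {y}) + (\<beta> * f (T - {y} \<union> {x}) - p (T - {y} \<union> {x}))"
    using y(1) by (intro bexI[of _ y]) (simp_all add: algebra_simps)
qed

text \<open>For \<open>T\<close> of the same size, exchange some \<open>x\<close> in
  \<open>S - T\<close>. The swapped \<open>S\<close> is no better than \<open>S\<close> by
  assumption, so the swapped \<open>T\<close> is no worse than \<open>T\<close>; it shares one more
  element with \<open>S\<close>, and the descent ends at \<open>S\<close>.\<close>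

lemma locally_optimal_imp_layer_optimal:
  assumes "ultra A h" "finite A" "S \<subseteq> A"
    and loc: "\<And>x y. x \<in> S \<Longrightarrow> y \<in> A - S \<Longrightarrow> h (insert y (S - {x})) \<le> h S"
  shows "layer_optimal A h S"
proof -
  have fin: "finite S" using assms finite_subset by blast
  have "h T \<le> h S" if "T \<subseteq> A" "card T = card S" for T
    using that
  proof (induction "card (S - T)" arbitrary: T rule: less_induct)
    case less
    have finT: "finite T" using less.prems assms finite_subset by blast
    show ?case
    proof (cases "S \<subseteq> T")
      case True
      then have "S = T" using less.prems finT by (simp add: card_subset_eq)
      then show ?thesis by simp
    next
      case False
      then obtain x where x: "x \<in> S - T" by blast
      from ultraE[OF assms(1,3) less.prems(1) _ x] less.prems(2) obtain y where y: "y \<in> T - S"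
        "h S + h T \<le> h (insert y (S - {x})) + h (insert x (T - {y}))" by auto
      let ?T = "insert x (T - {y})"
      have "h T \<le> h ?T" using y loc[of x y] x less.prems by force
      also have "\<dots> \<le> h S"
      proof (rule less.hyps)
        show "card (S - ?T) < card (S - T)"
          using fin x y by (intro psubset_card_mono) auto
        show "?T \<subseteq> A" using x less.prems assms by auto
        show "card ?T = card S" using card_swap[of T y x] finT x y less.prems by auto
      qed
      finally show ?thesis .
    qed
  qed
  with assms show ?thesis by (auto simp: layer_optimal_def)
qed

text \<open>The same descent for \<open>T\<close> one larger than \<open>S\<close>, with the
  exchange property applied to sets of different sizes: the swapped \<open>S\<close> stays in the
  layer of \<open>S\<close> and is no better. The descent ends at some \<open>insert z S\<close>,
  which the greedy choice dominates.\<close>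

lemma greedy_extension_layer_optimal:
  assumes "ultra A h" "finite A" "layer_optimal A h S" "y \<in> A - S"
    and best: "\<And>z. z \<in> A - S \<Longrightarrow> h (insert z S) \<le> h (insert y S)"
  shows "layer_optimal A h (insert y S)"
proof -
  have SA: "S \<subseteq> A" and fin: "finite S"
    using assms finite_subset by (auto simp: layer_optimal_def)
  have "h T \<le> h (insert y S)" if "T \<subseteq> A" "card T = Suc (card S)" for T
    using that
  proof (induction "card (S - T)" arbitrary: T rule: less_induct)
    case less
    have finT: "finite T" using less.prems assms finite_subset by blast
    show ?case
    proof (cases "S \<subseteq> T")
      case True
      then have "card (T - S) = 1" using less.prems fin by (simp add: card_Diff_subset)
      then obtain z where "T - S = {z}" by (auto simp: card_1_singleton_iff)
      then have "T = insert z S" "z \<in> A - S" using True less.prems by auto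
      then show ?thesis using best by blast
    next
      case False
      then obtain x where x: "x \<in> S - T" by blast
      from ultraE[OF assms(1) SA less.prems(1) _ x] less.prems(2) obtain z where z: "z \<in> T - S"
        "h S + h T \<le> h (insert z (S - {x})) + h (insert x (T - {z}))" by auto
      let ?T = "insert x (T - {z})"
      have "h (insert z (S - {x})) \<le> h S"
      proof -
        have "card (insert z (S - {x})) = card S" "insert z (S - {x}) \<subseteq> A"
          using card_swap[of S x z] fin x z less.prems SA by auto
        then show ?thesis using assms(3) unfolding layer_optimal_def by blast
      qed
      then have "h T \<le> h ?T" using z by linarith
      also have "\<dots> \<le> h (insert y S)"
      proof (rule less.hyps)
        show "card (S - ?T) < card (S - T)"
          using fin x z by (intro psubset_card_mono) auto
        show "?T \<subseteq> A" using x less.prems SA by auto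
        show "card ?T = Suc (card S)" using card_swap[of T z x] finT x z less.prems by auto
      qed
      finally show ?thesis .
    qed
  qed
  with assms SA fin show ?thesis by (auto simp: layer_optimal_def)
qed

text \<open>The contract at which the lines of \<open>S\<close> and \<open>T\<close> cross when only
  the additive cost is counted; on a layer the symmetric cost cancels. It is consulted only where
  \<open>f T < f S\<close>.\<close>

definition swap_ratio :: "('a set \<Rightarrow> real) \<Rightarrow> ('a set \<Rightarrow> real) \<Rightarrow> 'a set \<Rightarrow> 'a set \<Rightarrow> real" where
  "swap_ratio f p S T = (p S - p T) / (f S - f T)"

definition swap_ratios_le ::
  "'a set \<Rightarrow> ('a set \<Rightarrow> real) \<Rightarrow> ('a set \<Rightarrow> real) \<Rightarrow> 'a set \<Rightarrow> real \<Rightarrow> bool" where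
  "swap_ratios_le A f p S r \<longleftrightarrow> (\<forall>x\<in>S. \<forall>y\<in>A - S. f (insert y (S - {x})) < f S \<longrightarrow>
     swap_ratio f p S (insert y (S - {x})) \<le> r)"

text \<open>By local optimality only single swaps matter. A swap that lowers the reward overtakes
  \<open>S\<close> only below its ratio; any other swap is dominated at \<open>\<alpha>\<close> and
  gains nothing on \<open>S\<close> when the contract falls.\<close>

lemma layer_optimal_until_swap:
  assumes "ultra A f" "additive_set_fun A p" "finite A"
    and opt: "layer_optimal A (\<lambda>S. \<alpha> * f S - p S) S"
    and ratios: "swap_ratios_le A f p S r" and "r \<le> \<beta>" "0 \<le> \<beta>" "\<beta> \<le> \<alpha>"
  shows "layer_optimal A (\<lambda>S. \<beta> * f S - p S) S"
proof (rule locally_optimal_imp_layer_optimal)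
  show "ultra A (\<lambda>S. \<beta> * f S - p S)" using assms by (intro ultra_priced)
  show SA: "S \<subseteq> A" using opt by (simp add: layer_optimal_def)
  fix x y assume xy: "x \<in> S" "y \<in> A - S"
  let ?T = "insert y (S - {x})"
  have "finite S" using SA assms(3) finite_subset by blast
  then have "card ?T = card S" "?T \<subseteq> A" using card_swap[of S x y] xy SA by auto
  then have le: "\<alpha> * f ?T - p ?T \<le> \<alpha> * f S - p S" using opt unfolding layer_optimal_def by blast
  show "\<beta> * f ?T - p ?T \<le> \<beta> * f S - p S"
  proof (cases "f ?T < f S")
    case True
    then have "swap_ratio f p S ?T \<le> \<beta>"
      using ratios xy \<open>r \<le> \<beta>\<close> unfolding swap_ratios_le_def by force
    then have "p S - p ?T \<le> \<beta> * (f S - f ?T)"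
      using True by (simp add: swap_ratio_def pos_divide_le_eq)
    then show ?thesis by (simp add: algebra_simps)
  next
    case False
    then have "\<beta> * (f ?T - f S) \<le> \<alpha> * (f ?T - f S)"
      using \<open>\<beta> \<le> \<alpha>\<close> by (intro mult_right_mono) auto
    with le show ?thesis by (simp add: algebra_simps)
  qed
qed (use assms in auto)

text \<open>The potential of the sweep. Unlike the price \<open>p S\<close> it is integral and has a
  bound in \<open>n\<close>, so its decrease limits the number of moves. Elements of equal price get
  equal rank.\<close>

definition rank_sum :: "'a set \<Rightarrow> ('a set \<Rightarrow> real) \<Rightarrow> 'a set \<Rightarrow> nat" where
  "rank_sum A p S = (\<Sum>a\<in>S. card {b\<in>A. p {b} < p {a}})"

lemma rank_sum_le:
  assumes "finite A" "S \<subseteq> A"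
  shows "rank_sum A p S \<le> card A * card A"
proof -
  have "rank_sum A p S \<le> card S * card A"
    unfolding rank_sum_def
    using sum_bounded_above[of S "\<lambda>a. card {b\<in>A. p {b} < p {a}}" "card A"] assms
    by (simp add: card_mono)
  also have "\<dots> \<le> card A * card A" using assms by (simp add: card_mono)
  finally show ?thesis .
qed

lemma rank_sum_swap_less:
  assumes "finite A" "S \<subseteq> A" "x \<in> S" "y \<in> A - S" "p {y} < p {x}"
  shows "rank_sum A p (insert y (S - {x})) < rank_sum A p S"
proof -
  let ?w = "\<lambda>a. card {b\<in>A. p {b} < p {a}}"
  have "finite S" using assms finite_subset by blast
  \<comment> \<open>The inclusion is strict because \<open>y\<close> is counted for \<open>x\<close>
    but not for itself.\<close>
  have "?w y < ?w x" using assms by (intro psubset_card_mono) auto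
  then have "sum ?w (insert y (S - {x})) < ?w x + sum ?w (S - {x})"
    using assms \<open>finite S\<close> by simp
  also have "\<dots> = sum ?w S" using assms \<open>finite S\<close> by (simp add: sum.remove)
  finally show ?thesis by (simp add: rank_sum_def)
qed

text \<open>One move of the kinetic search: the swap that is the next to become optimal when the
  contract decreases, if there is one.\<close>

definition next_swap ::
  "'a set \<Rightarrow> ('a set \<Rightarrow> real) \<Rightarrow> ('a set \<Rightarrow> real) \<Rightarrow> 'a set \<Rightarrow> 'a set \<Rightarrow> bool" where
  "next_swap A f p S S' \<longleftrightarrow> (\<exists>r\<ge>0. swap_ratios_le A f p S r \<and>
     (r = 0 \<and> S' = S \<or>
      0 < r \<and> (\<exists>x\<in>S. \<exists>y\<in>A - S. S' = insert y (S - {x})) \<and> f S' < f S \<and> swap_ratio f p S S' = r))"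


section \<open>The upper envelope of the recorded lines\<close>

text \<open>A set \<open>S\<close> is recorded as the pair of \<open>f S\<close> and \<open>c S\<close>, which represents the line
  \<open>\<alpha> \<mapsto> \<alpha> f S - c S\<close>. The threshold of a line is the least contract at which it
  can be on the envelope.\<close>

definition threshold :: "(real \<times> real) set \<Rightarrow> real \<times> real \<Rightarrow> real \<Rightarrow> bool" where
  "threshold L l r \<longleftrightarrow> 0 \<le> r \<and>
     (\<forall>m\<in>L. fst m < fst l \<longrightarrow> (snd l - snd m) / (fst l - fst m) \<le> r) \<and>
     (r = 0 \<or> (\<exists>m\<in>L. fst m < fst l \<and> r = (snd l - snd m) / (fst l - fst m)))"

text \<open>For a fixed line with nonnegative slope the principal's utility does not grow with the
  contract, so the threshold is the only contract worth considering, provided the line attains the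
  envelope there.\<close>

definition admissible :: "(real \<times> real) set \<Rightarrow> real \<times> real \<Rightarrow> real \<Rightarrow> bool" where
  "admissible L l r \<longleftrightarrow> threshold L l r \<and> r \<le> 1 \<and>
     (\<forall>m\<in>L. r * fst m - snd m \<le> r * fst l - snd l)"

lemma threshold_ex:
  assumes "finite L"
  shows "\<exists>r. threshold L l r"
proof -
  let ?R = "insert 0 ((\<lambda>m. (snd l - snd m) / (fst l - fst m)) ` {m\<in>L. fst m < fst l})"
  have fin: "finite ?R" using assms by simp
  then have "Max ?R \<in> ?R" by (intro Max_in) auto
  then have "threshold L l (Max ?R)"
    unfolding threshold_def using fin by (auto intro!: Max_ge)
  then show ?thesis by blast
qed

lemma threshold_unique: "threshold L l r \<Longrightarrow> threshold L l r' \<Longrightarrow> r = r'"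
  unfolding threshold_def by (metis order_antisym)

text \<open>Some demanded set per contract suffices, not necessarily a best response, and the
  contract 0 is left out: \<open>lines_cover_best_response\<close> approaches each contract from
  above, which supplies both.\<close>

definition lines_cover ::
  "'a set \<Rightarrow> ('a set \<Rightarrow> real) \<Rightarrow> ('a set \<Rightarrow> real) \<Rightarrow> (real \<times> real) set \<Rightarrow> bool" where
  "lines_cover A f c L \<longleftrightarrow> L \<subseteq> (\<lambda>S. (f S, c S)) ` Pow A \<and>
     (\<forall>\<beta>. 0 < \<beta> \<and> \<beta> \<le> 1 \<longrightarrow> (\<exists>T\<in>agent_demand A f c \<beta>. (f T, c T) \<in> L))"

lemma mem_agent_demand:
  "S \<in> agent_demand A f c \<alpha> \<longleftrightarrow> S \<subseteq> A \<and> (\<forall>T\<subseteq>A. \<alpha> * f T - c T \<le> \<alpha> * f S - c S)"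
  by (auto simp: agent_demand_def is_arg_max_linorder agent_utility_def)

lemma mem_best_responses:
  "S \<in> best_responses A f c \<alpha> \<longleftrightarrow>
     S \<in> agent_demand A f c \<alpha> \<and> (\<forall>T\<in>agent_demand A f c \<alpha>. f T \<le> f S)"
  by (auto simp: best_responses_def is_arg_max_linorder)

text \<open>A line on the envelope at all contracts slightly above \<open>\<alpha>\<close> is on the envelope at \<open>\<alpha>\<close>
  and has maximal slope there.\<close>

lemma lines_cover_best_response:
  assumes "finite A" "lines_cover A f c L" "0 \<le> \<alpha>" "\<alpha> < 1"
  obtains T where "T \<in> best_responses A f c \<alpha>" "(f T, c T) \<in> L"
proof -
  let ?ratio = "\<lambda>(S, T). (c S - c T) / (f S - f T)"
  \<comment> \<open>The crossings of two lines above \<open>\<alpha>\<close>; \<open>\<beta>\<close>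
    is chosen before the first of them. The 1 keeps the set nonempty and \<open>\<beta>\<close> at
    most 1. Equal rewards give the ratio 0 by division by zero, discarded since
    \<open>0 \<le> \<alpha>\<close>.\<close>
  let ?R = "insert 1 {q \<in> ?ratio ` (Pow A \<times> Pow A). \<alpha> < q}"
  define \<beta> where "\<beta> = (\<alpha> + Min ?R) / 2"
  have fin: "finite ?R" using assms(1) by simp
  have "Min ?R \<in> ?R" using fin by (intro Min_in) auto
  then have "\<alpha> < Min ?R" using assms(4) by auto
  moreover have "Min ?R \<le> 1" using fin by (intro Min_le) auto
  ultimately have \<beta>: "\<alpha> < \<beta>" "\<beta> \<le> 1" "\<beta> < Min ?R" by (auto simp: \<beta>_def)
  then obtain T where T: "T \<in> agent_demand A f c \<beta>" "(f T, c T) \<in> L"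
    using assms(2,3) unfolding lines_cover_def by force
  have above: "\<beta> * f U - c U \<le> \<beta> * f T - c T" if "U \<subseteq> A" for U
    using T(1) that by (simp add: mem_agent_demand)
  have TA: "T \<subseteq> A" using T(1) by (simp add: mem_agent_demand)
  have demand: "\<alpha> * f U - c U \<le> \<alpha> * f T - c T" if U: "U \<subseteq> A" for U
  proof (rule ccontr)
    \<comment> \<open>A set better than \<open>T\<close> at \<open>\<alpha>\<close> but not at
      \<open>\<beta>\<close> would cross \<open>T\<close> in between, where no crossing
      lies.\<close>
    assume neg: "\<not> ?thesis"
    with above[OF U] have "0 < (\<beta> - \<alpha>) * (f T - f U)" by (simp add: algebra_simps)
    then have pos: "0 < f T - f U" using \<beta> by (simp add: zero_less_mult_iff)
    let ?q = "(c T - c U) / (f T - f U)"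
    have "?q \<le> \<beta>" "\<alpha> < ?q"
      using above[OF U] neg pos by (simp_all add: pos_divide_le_eq pos_less_divide_eq algebra_simps)
    then have "?q \<in> ?R" using TA U by force
    then have "Min ?R \<le> ?q" using fin by (intro Min_le)
    with \<open>?q \<le> \<beta>\<close> \<beta> show False by simp
  qed
  have "f U \<le> f T" if U: "U \<in> agent_demand A f c \<alpha>" for U
  proof -
    have "\<alpha> * f T - c T \<le> \<alpha> * f U - c U" "U \<subseteq> A"
      using U TA by (simp_all add: mem_agent_demand)
    with above[of U] have "0 \<le> (\<beta> - \<alpha>) * (f T - f U)" by (simp add: algebra_simps)
    with \<beta> show ?thesis by (simp add: zero_le_mult_iff)
  qed
  with demand TA have "T \<in> best_responses A f c \<alpha>"
    by (auto simp: mem_best_responses mem_agent_demand)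
  with T(2) that show thesis by blast
qed

text \<open>Ties in the demand are broken in favour of the reward, so any demanded set gives a lower
  bound.\<close>

lemma principal_utility_ge:
  assumes "finite A" "S \<in> agent_demand A f c \<alpha>" "\<alpha> \<le> 1"
  shows "(1 - \<alpha>) * f S \<le> principal_utility A f c \<alpha>"
proof -
  from best_responses_nonempty[OF assms(1)] obtain T where T: "T \<in> best_responses A f c \<alpha>" by blast
  then have "f S \<le> f T" using assms(2) by (simp add: mem_best_responses)
  then show ?thesis
    using principal_utility_eq[OF T] assms(3) by (simp add: mult_left_mono)
qed

text \<open>No contract beats \<open>v\<close>: the line of a best response stays on the envelope
  when the contract falls to its threshold, and the principal's share only grows. Conversely, an
  admissible line belongs to a set demanded at \<open>r\<close>, so \<open>r\<close> yields at least
  \<open>v\<close>.\<close>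

lemma optimal_contract_from_lines:
  assumes A: "finite A" and nonneg: "nonneg_set_fun A f" and cover: "lines_cover A f c L"
    and v: "0 \<le> v" "v = 0 \<and> r = 0 \<or> (\<exists>l\<in>L. admissible L l r \<and> v = (1 - r) * fst l)"
    and max: "\<And>l r. l \<in> L \<Longrightarrow> admissible L l r \<Longrightarrow> (1 - r) * fst l \<le> v"
  shows "optimal_contract A f c r"
proof -
  have L: "finite L" using cover A finite_subset by (fastforce simp: lines_cover_def)
  have upper: "principal_utility A f c \<alpha> \<le> v" if \<alpha>: "0 \<le> \<alpha>" "\<alpha> \<le> 1" for \<alpha>
  proof (cases "\<alpha> = 1")
    case True
    then show ?thesis using v(1) by (simp add: principal_utility_def)
  next
    case False
    then have "\<alpha> < 1" using \<alpha> by simp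
    from lines_cover_best_response[OF A cover \<alpha>(1) this] obtain T
      where T: "T \<in> best_responses A f c \<alpha>" "(f T, c T) \<in> L" .
    have top: "\<alpha> * fst m - snd m \<le> \<alpha> * f T - c T" if m: "m \<in> L" for m
    proof -
      obtain S where "S \<subseteq> A" "m = (f S, c S)" using m cover by (auto simp: lines_cover_def)
      then show ?thesis using T(1) by (simp add: mem_best_responses mem_agent_demand)
    qed
    obtain r where r: "threshold L (f T, c T) r" using threshold_ex[OF L] by blast
    \<comment> \<open>Being on the envelope at \<open>\<alpha>\<close>, the line of \<open>T\<close>
      crosses every flatter line at or before \<open>\<alpha>\<close>.\<close>
    have "r \<le> \<alpha>"
    proof (cases "r = 0")
      case False
      then obtain m where m: "m \<in> L" "fst m < f T" "r = (c T - snd m) / (f T - fst m)"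
        using r by (auto simp: threshold_def)
      then show ?thesis using top[OF m(1)] by (simp add: pos_divide_le_eq algebra_simps)
    qed (use \<alpha> in simp)
    have "r * fst m - snd m \<le> r * f T - c T" if m: "m \<in> L" for m
    proof (cases "fst m < f T")
      case True
      then have "(c T - snd m) / (f T - fst m) \<le> r" using r m by (simp add: threshold_def)
      then show ?thesis using True by (simp add: pos_divide_le_eq algebra_simps)
    next
      case False
      then have "r * (fst m - f T) \<le> \<alpha> * (fst m - f T)"
        using \<open>r \<le> \<alpha>\<close> by (intro mult_right_mono) auto
      with top[OF m] show ?thesis by (simp add: algebra_simps)
    qed
    then have "admissible L (f T, c T) r"
      using r \<open>r \<le> \<alpha>\<close> \<alpha> by (simp add: admissible_def)
    then have "(1 - r) * f T \<le> v" using max[OF T(2)] by simp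
    moreover have "0 \<le> f T"
      using T(1) nonneg by (simp add: mem_best_responses mem_agent_demand nonneg_set_fun_def)
    then have "(1 - \<alpha>) * f T \<le> (1 - r) * f T"
      using \<open>r \<le> \<alpha>\<close> by (intro mult_right_mono) auto
    ultimately show ?thesis using principal_utility_eq[OF T(1)] by simp
  qed
  have "0 \<le> r \<and> r \<le> 1 \<and> v \<le> principal_utility A f c r"
    using v(2)
  proof
    \<comment> \<open>The default pair, kept when no admissible line has positive value; the
      contract 0 never yields less than 0.\<close>
    assume "v = 0 \<and> r = 0"
    moreover obtain T where "T \<in> best_responses A f c 0" using best_responses_nonempty[OF A] by blast
    ultimately show ?thesis
      using nonneg principal_utility_eq[of T A f c 0]
      by (auto simp: mem_best_responses mem_agent_demand nonneg_set_fun_def)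
  next
    assume "\<exists>l\<in>L. admissible L l r \<and> v = (1 - r) * fst l"
    then obtain l where l: "l \<in> L" "admissible L l r" "v = (1 - r) * fst l" by blast
    then have r: "0 \<le> r" "r \<le> 1" by (auto simp: admissible_def threshold_def)
    have "v \<le> principal_utility A f c r"
    proof (cases "r = 1")
      case True
      then show ?thesis using l(3) by (simp add: principal_utility_def)
    next
      case False
      then have "r < 1" using r by simp
      from lines_cover_best_response[OF A cover r(1) this] obtain T
        where T: "T \<in> best_responses A f c r" "(f T, c T) \<in> L" .
      obtain S where S: "S \<subseteq> A" "l = (f S, c S)" using l(1) cover by (auto simp: lines_cover_def)
      have "r * f T - c T \<le> r * f S - c S"
        using l(2) T(2) S(2) by (force simp: admissible_def)
      then have "S \<in> agent_demand A f c r"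
        using T(1) S(1) unfolding mem_best_responses mem_agent_demand by (blast intro: order_trans)
      from principal_utility_ge[OF A this r(2)] show ?thesis using l(3) S(2) by simp
    qed
    with r show ?thesis by simp
  qed
  then show ?thesis
    using upper unfolding optimal_contract_def is_arg_max_linorder by (blast intro: order_trans)
qed

section \<open>The algorithm's invariants\<close>

locale spa_contract =
  fixes n :: nat and f g p :: "nat set \<Rightarrow> real"
  assumes f_nonneg: "nonneg_set_fun {..<n} f" and f_ultra: "ultra {..<n} f"
    and g_symmetric: "symmetric_set_fun {..<n} g" and p_additive: "additive_set_fun {..<n} p"
begin

definition cost :: "nat set \<Rightarrow> real" where
  "cost S = g S + p S"

text \<open>The symmetric cost is constant on a layer and is left out.\<close>

definition optimal_at :: "real \<Rightarrow> nat set \<Rightarrow> bool" where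
  "optimal_at \<beta> S \<longleftrightarrow> layer_optimal {..<n} (\<lambda>S. \<beta> * f S - p S) S"

definition covered :: "(real \<times> real) set \<Rightarrow> nat \<Rightarrow> real \<Rightarrow> bool" where
  "covered L i \<beta> \<longleftrightarrow> (\<exists>T. card T = i \<and> optimal_at \<beta> T \<and> (f T, cost T) \<in> L)"

text \<open>\<open>k\<close> counts the moves made. While the layer is unfinished each move lowers
  the rank sum, which starts at no more than \<open>n * n\<close>; after more than
  \<open>n * n\<close> moves only the second alternative, a finished layer, is left. Coverage is
  asked strictly above \<open>\<alpha>\<close> because \<open>S\<close> is not yet recorded.\<close>

definition sweep_inv :: "(real \<times> real) set \<Rightarrow> nat \<Rightarrow> nat set \<Rightarrow> nat \<Rightarrow> bool" where
  "sweep_inv L i S k \<longleftrightarrow> S \<subseteq> {..<n} \<and> card S = i \<and>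
     ((\<exists>\<alpha>. 0 < \<alpha> \<and> \<alpha> \<le> 1 \<and> optimal_at \<alpha> S \<and> (\<forall>\<beta>. \<alpha> < \<beta> \<and> \<beta> \<le> 1 \<longrightarrow> covered L i \<beta>) \<and>
        rank_sum {..<n} p S + k \<le> n * n) \<or>
      (\<forall>\<beta>. 0 < \<beta> \<and> \<beta> \<le> 1 \<longrightarrow> covered L i \<beta>))"

section \<open>Progress and end of the sweep\<close>

lemma covered_mono: "covered L i \<beta> \<Longrightarrow> L \<subseteq> L' \<Longrightarrow> covered L' i \<beta>"
  by (auto simp: covered_def)

lemma sweep_inv_start:
  assumes "optimal_at 1 S"
  shows "sweep_inv L (card S) S 0"
  using assms rank_sum_le[of "{..<n}" S p]
  by (auto simp: sweep_inv_def optimal_at_def layer_optimal_def intro!: exI[of _ 1])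

lemma next_swap_subset_card:
  assumes "next_swap {..<n} f p S S'" "S \<subseteq> {..<n}"
  shows "S' \<subseteq> {..<n}" "card S' = card S"
proof -
  have "finite S" using assms finite_subset by blast
  then show "S' \<subseteq> {..<n}" "card S' = card S"
    using assms card_swap[of S] unfolding next_swap_def by fastforce+
qed

text \<open>Recording \<open>S\<close> covers the contracts from \<open>r\<close> to
  \<open>\<alpha>\<close>. If the layer is still unfinished, \<open>S'\<close> ties with
  \<open>S\<close> at \<open>r\<close> and takes over there at a lower price. Ties may give
  \<open>r = \<alpha>\<close>; progress is then due to the rank sum alone.\<close>

lemma sweep_inv_step:
  assumes inv: "sweep_inv L i S k" and swap: "next_swap {..<n} f p S S'"
  shows "sweep_inv (insert (f S, cost S) L) i S' (Suc k)"
proof -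
  let ?A = "{..<n}" and ?L = "insert (f S, cost S) L"
  have S: "S \<subseteq> ?A" "card S = i" using inv by (auto simp: sweep_inv_def)
  have S': "S' \<subseteq> ?A" "card S' = i" using next_swap_subset_card[OF swap S(1)] S(2) by auto
  show ?thesis
  proof (cases "\<forall>\<beta>. 0 < \<beta> \<and> \<beta> \<le> 1 \<longrightarrow> covered ?L i \<beta>")
    case True
    with S' show ?thesis by (simp add: sweep_inv_def)
  next
    case False
    then have "\<not> (\<forall>\<beta>. 0 < \<beta> \<and> \<beta> \<le> 1 \<longrightarrow> covered L i \<beta>)" using covered_mono by blast
    with inv obtain \<alpha> where \<alpha>: "0 < \<alpha>" "\<alpha> \<le> 1" "optimal_at \<alpha> S"
      "\<And>\<beta>. \<alpha> < \<beta> \<Longrightarrow> \<beta> \<le> 1 \<Longrightarrow> covered L i \<beta>" "rank_sum ?A p S + k \<le> n * n"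
      unfolding sweep_inv_def by blast
    from swap obtain r where r: "0 \<le> r" "swap_ratios_le ?A f p S r"
      "r = 0 \<and> S' = S \<or>
       0 < r \<and> (\<exists>x\<in>S. \<exists>y\<in>?A - S. S' = insert y (S - {x})) \<and> f S' < f S \<and> swap_ratio f p S S' = r"
      unfolding next_swap_def by blast
    have opt: "optimal_at \<beta> S" if "r \<le> \<beta>" "\<beta> \<le> \<alpha>" for \<beta>
      using layer_optimal_until_swap[OF f_ultra p_additive _ _ r(2) that(1) _ that(2)] \<alpha>(3) r(1) that
      by (simp add: optimal_at_def)
    have cov: "covered ?L i \<beta>" if "r \<le> \<beta>" "\<beta> \<le> 1" for \<beta>
    proof (cases "\<beta> \<le> \<alpha>")
      case True
      then show ?thesis using opt that S(2) by (auto simp: covered_def)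
    next
      case False
      then show ?thesis using \<alpha>(4)[of \<beta>] that covered_mono by (meson not_le subset_insertI)
    qed
    \<comment> \<open>With \<open>r = 0\<close> all positive contracts would now be covered, against
      the case assumption.\<close>
    have "r \<noteq> 0" using False cov by force
    with r(3) obtain x y where xy: "x \<in> S" "y \<in> ?A - S" "S' = insert y (S - {x})"
      and r': "0 < r" "f S' < f S" "swap_ratio f p S S' = r" by blast
    have ratio: "r * (f S - f S') = p S - p S'"
      using r'(2,3) by (auto simp: swap_ratio_def)
    \<comment> \<open>\<open>S'\<close> has the smaller reward and does not beat \<open>S\<close> at
      \<open>\<alpha>\<close>, so the two cross at or below \<open>\<alpha>\<close>.\<close>
    have "\<alpha> * f S' - p S' \<le> \<alpha> * f S - p S"
      using \<alpha>(3) S S' by (simp add: optimal_at_def layer_optimal_def)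
    then have "p S - p S' \<le> \<alpha> * (f S - f S')" by (simp add: algebra_simps)
    then have "r \<le> \<alpha>" using r'(2) ratio by (metis diff_gt_0_iff_gt mult_le_cancel_right_pos)
    have "optimal_at r S" using opt \<open>r \<le> \<alpha>\<close> by simp
    moreover have "r * f S' - p S' = r * f S - p S" using ratio by (simp add: algebra_simps)
    ultimately have optS': "optimal_at r S'"
      using S S' by (simp add: optimal_at_def layer_optimal_def)
    have "0 < r * (f S - f S')" using r' by simp
    then have "p {y} < p {x}"
      using ratio additive_swap[OF p_additive _ S(1) xy(1,2)] xy(3) by simp
    then have "rank_sum ?A p S' < rank_sum ?A p S"
      using rank_sum_swap_less[of ?A S x y p] S(1) xy by simp
    then show ?thesis
      using S' r'(1) \<open>r \<le> \<alpha>\<close> \<alpha>(2,5) optS' cov by (auto simp: sweep_inv_def intro!: exI[of _ r])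
  qed
qed

lemma sweep_inv_end:
  assumes "sweep_inv L i S k" "n * n < k" "0 < \<beta>" "\<beta> \<le> 1"
  shows "covered L i \<beta>"
  using assms by (auto simp: sweep_inv_def)

text \<open>A demanded set competes with the recorded optimum of its own layer, which has the same
  symmetric cost and is therefore demanded too.\<close>

lemma covered_imp_lines_cover:
  assumes "L \<subseteq> (\<lambda>S. (f S, cost S)) ` Pow {..<n}"
    and cov: "\<And>i \<beta>. i \<le> n \<Longrightarrow> 0 < \<beta> \<Longrightarrow> \<beta> \<le> 1 \<Longrightarrow> covered L i \<beta>"
  shows "lines_cover {..<n} f cost L"
  unfolding lines_cover_def
proof (intro conjI allI impI assms(1))
  fix \<beta> :: real assume \<beta>: "0 < \<beta> \<and> \<beta> \<le> 1"
  obtain S where S: "S \<in> agent_demand {..<n} f cost \<beta>"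
    using best_responses_nonempty[of "{..<n}" f cost \<beta>] by (auto simp: mem_best_responses)
  then have SA: "S \<subseteq> {..<n}" by (simp add: mem_agent_demand)
  then have "card S \<le> n" using card_mono[of "{..<n}" S] by simp
  with cov \<beta> obtain T where T: "card T = card S" "optimal_at \<beta> T" "(f T, cost T) \<in> L"
    unfolding covered_def by blast
  then have "T \<subseteq> {..<n}" "\<beta> * f S - p S \<le> \<beta> * f T - p T"
    using SA by (simp_all add: optimal_at_def layer_optimal_def)
  moreover from this have "g S = g T"
    using g_symmetric[unfolded symmetric_set_fun_def, rule_format, of S T] SA T(1) by simp
  ultimately have "T \<in> agent_demand {..<n} f cost \<beta>"
    using S unfolding mem_agent_demand cost_def by (smt (verit))
  with T(3) show "\<exists>T\<in>agent_demand {..<n} f cost \<beta>. (f T, cost T) \<in> L" by blast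
qed

end


section \<open>The program\<close>

text \<open>\<open>held_set\<close> as a function of a single array, so that array updates turn into
  set updates.\<close>

definition support_upto :: "nat \<Rightarrow> (nat \<Rightarrow> nat) \<Rightarrow> nat set" where
  "support_upto n m = {i. i < n \<and> m i \<noteq> 0}"

lemma held_set_support_upto: "held_set n b s = support_upto n (nats s b)"
  by (simp add: held_set_def support_upto_def)

lemma support_upto_update [simp]:
  "support_upto n (m(i := v)) =
     (if i < n \<and> v \<noteq> 0 then insert i (support_upto n m) else support_upto n m - {i})"
  by (auto simp: support_upto_def)

lemma mem_support_upto: "i < n \<Longrightarrow> i \<in> support_upto n m \<longleftrightarrow> 0 < m i"
  by (simp add: support_upto_def)

lemma support_upto_subset: "support_upto n m \<subseteq> {..<n}"
  by (auto simp: support_upto_def)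

text \<open>Arrays of natural numbers; all but the sets \<open>vbase\<close> and \<open>vwork\<close> are used as scalars.
  The value \<open>n\<close> of \<open>vin\<close> or \<open>vout\<close> means that no element has been chosen; a write to
  position \<open>n\<close> of a set does not change the held set.\<close>

abbreviation (input) "vsize \<equiv> 0 :: nat"
abbreviation (input) "vbase \<equiv> 2 :: nat"
abbreviation (input) "vwork \<equiv> 3 :: nat"
abbreviation (input) "vlayer \<equiv> 4 :: nat"
abbreviation (input) "vround1 \<equiv> 5 :: nat"
abbreviation (input) "vround2 \<equiv> 6 :: nat"
abbreviation (input) "vx \<equiv> 7 :: nat"
abbreviation (input) "vy \<equiv> 8 :: nat"
abbreviation (input) "vout \<equiv> 9 :: nat"
abbreviation (input) "vin \<equiv> 10 :: nat"
abbreviation (input) "vlines \<equiv> 11 :: nat"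
abbreviation (input) "vline \<equiv> 12 :: nat"
abbreviation (input) "vother \<equiv> 13 :: nat"
abbreviation (input) "vtop \<equiv> 14 :: nat"

text \<open>Arrays of reals; \<open>rslope\<close> and \<open>rlcost\<close> hold the recorded lines.\<close>

abbreviation (input) "rresult \<equiv> 0 :: nat"
abbreviation (input) "rslope \<equiv> 2 :: nat"
abbreviation (input) "rlcost \<equiv> 3 :: nat"
abbreviation (input) "rbest \<equiv> 4 :: nat"
abbreviation (input) "rf' \<equiv> 5 :: nat"
abbreviation (input) "rp' \<equiv> 6 :: nat"
abbreviation (input) "rf \<equiv> 7 :: nat"
abbreviation (input) "rp \<equiv> 8 :: nat"
abbreviation (input) "rthr \<equiv> 9 :: nat"
abbreviation (input) "rvalue \<equiv> 10 :: nat"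

text \<open>A greedy step at the contract 1. Since \<open>f - p\<close> may be negative, the absence
  of a candidate is signalled by \<open>vin\<close> and not by a value of
  \<open>rbest\<close>.\<close>

definition extend_base :: com where
  "extend_base =
     set_nat vin (ncell vsize) ;;
     For vy (ncell vsize)
       (Cond (NLess (Num 0) (NCell vbase (ncell vy))) Skip
         (NAssign vbase (ncell vy) (Num 1) ;;
          Query Reward rf' (Num 0) vbase ;;
          Query AddCost rp' (Num 0) vbase ;;
          NAssign vbase (ncell vy) (Num 0) ;;
          Cond (BAnd (NLess (ncell vin) (ncell vsize))
                 (BNot (RLess (rcell rbest) (RSub (rcell rf') (rcell rp'))))) Skip
            (set_real rbest (RSub (rcell rf') (rcell rp')) ;;
             set_nat vin (ncell vy)))) ;;
     NAssign vbase (ncell vin) (Num 1)"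

text \<open>The swap is made in place and undone after the queries. The best ratio starts at 0, so a
  swap that does not lower the additive cost is never taken.\<close>

definition try_swap :: com where
  "try_swap =
     NAssign vwork (ncell vx) (Num 0) ;;
     NAssign vwork (ncell vy) (Num 1) ;;
     Query Reward rf' (Num 0) vwork ;;
     Query AddCost rp' (Num 0) vwork ;;
     NAssign vwork (ncell vy) (Num 0) ;;
     NAssign vwork (ncell vx) (Num 1) ;;
     Cond (BAnd (RLess (rcell rf') (rcell rf))
            (RLess (rcell rbest)
              (RDiv (RSub (rcell rp) (rcell rp')) (RSub (rcell rf) (rcell rf')))))
       (set_real rbest (RDiv (RSub (rcell rp) (rcell rp')) (RSub (rcell rf) (rcell rf'))) ;;
        set_nat vout (ncell vx) ;;
        set_nat vin (ncell vy))
       Skip"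

definition swap_work :: com where
  "swap_work =
     set_real rbest RZero ;;
     set_nat vout (ncell vsize) ;;
     set_nat vin (ncell vsize) ;;
     Query Reward rf (Num 0) vwork ;;
     Query AddCost rp (Num 0) vwork ;;
     For vx (ncell vsize)
       (Cond (NLess (Num 0) (NCell vwork (ncell vx)))
         (For vy (ncell vsize)
           (Cond (NLess (Num 0) (NCell vwork (ncell vy))) Skip try_swap))
         Skip) ;;
     NAssign vwork (ncell vout) (Num 0) ;;
     NAssign vwork (ncell vin) (Num 1)"

definition record_line :: com where
  "record_line =
     Query Reward rslope (ncell vlines) vwork ;;
     Query SymCost rlcost (ncell vlines) vwork ;;
     Query AddCost rp' (Num 0) vwork ;;
     RAssign rlcost (ncell vlines) (RAdd (RCell rlcost (ncell vlines)) (rcell rp')) ;;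
     set_nat vlines (NAdd (ncell vlines) (Num 1))"

text \<open>Two nested loops give \<open>(n + 1) * (n + 1)\<close> rounds without multiplying
  natural numbers, more than the \<open>n * n\<close> moves that the rank sum allows.\<close>

definition sweep :: com where
  "sweep =
     For vround1 (NAdd (ncell vsize) (Num 1))
       (For vround2 (NAdd (ncell vsize) (Num 1)) (record_line ;; swap_work))"

text \<open>\<open>vbase\<close> keeps the optimum at the contract 1 for the next greedy step while
  the sweep alters a copy. After the last layer \<open>vbase\<close> is full, and its extension
  writes to position \<open>n\<close> only.\<close>

definition record_all :: com where
  "record_all =
     For vlayer (NAdd (ncell vsize) (Num 1))
       (For vx (ncell vsize) (NAssign vwork (ncell vx) (NCell vbase (ncell vx))) ;;
        sweep ;; extend_base)"

abbreviation (input) "rintersection \<equiv>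
  RDiv (RSub (RCell rlcost (ncell vline)) (RCell rlcost (ncell vother)))
    (RSub (RCell rslope (ncell vline)) (RCell rslope (ncell vother)))"

definition find_threshold :: com where
  "find_threshold =
     set_real rthr RZero ;;
     For vother (ncell vlines)
       (Cond (BAnd (RLess (RCell rslope (ncell vother)) (RCell rslope (ncell vline)))
               (RLess (rcell rthr) rintersection))
         (set_real rthr rintersection) Skip)"

abbreviation (input) "rline_at_thr v \<equiv>
  RSub (RMul (rcell rthr) (RCell rslope (ncell v))) (RCell rlcost (ncell v))"

definition check_top :: com where
  "check_top =
     set_nat vtop (Num 1) ;;
     For vother (ncell vlines)
       (Cond (RLess (rline_at_thr vline) (rline_at_thr vother)) (set_nat vtop (Num 0)) Skip)"

abbreviation (input) "rutility \<equiv> RMul (RSub ROne (rcell rthr)) (RCell rslope (ncell vline))"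

text \<open>\<open>rvalue\<close> and \<open>rresult\<close> still hold the initial zeros here,
  which serve as the default value and contract.\<close>

definition evaluate_lines :: com where
  "evaluate_lines =
     For vline (ncell vlines)
       (find_threshold ;; check_top ;;
        Cond (BAnd (NLess (Num 0) (ncell vtop))
               (BAnd (BNot (RLess ROne (rcell rthr))) (RLess (rcell rvalue) rutility)))
          (set_real rvalue rutility ;; set_real rresult (rcell rthr))
          Skip)"

definition program :: com where
  "program = record_all ;; evaluate_lines"


section \<open>Correctness of the program\<close>

definition line :: "state \<Rightarrow> nat \<Rightarrow> real \<times> real" where
  "line s j = (reals s rslope j, reals s rlcost j)"

definition lines_upto :: "state \<Rightarrow> nat \<Rightarrow> (real \<times> real) set" where
  "lines_upto s k = line s ` {..<k}"

abbreviation lines :: "state \<Rightarrow> (real \<times> real) set" where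
  "lines s \<equiv> lines_upto s (nats s vlines 0)"

lemma lines_upto_0 [simp]: "lines_upto s 0 = {}"
  by (simp add: lines_upto_def)

lemma lines_upto_Suc: "lines_upto s (Suc k) = insert (line s k) (lines_upto s k)"
  by (simp add: lines_upto_def lessThan_Suc)

lemma threshold_insert:
  assumes "threshold L l r"
  shows "threshold (insert m L) l
    (if fst m < fst l \<and> r < (snd l - snd m) / (fst l - fst m)
     then (snd l - snd m) / (fst l - fst m) else r)"
  using assms by (fastforce simp: threshold_def)

lemma runs_find_threshold:
  assumes "nats s vlines 0 \<le> M" "nats s vline 0 = j"
  shows "runs n orc M find_threshold s (\<lambda>s'. threshold (lines s) (line s j) (reals s' rthr 0))"
  unfolding find_threshold_def
proof (intro runs_Seq runs_RAssign,
    rule runs_For[where I = "\<lambda>k s'. threshold (lines_upto s k) (line s j) (reals s' rthr 0)"], goal_cases)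
  \<comment> \<open>The cases follow the premises of \<open>runs_For\<close>: 4 is the start of the
    invariant, 5 the body and 6 the exit.\<close>
  case (5 k s')
  have eqs: "reals s' rslope = reals s rslope" "reals s' rlcost = reals s rlcost" "nats s' vline = nats s vline"
    using 5(4) by (simp_all add: frame_def write_cell_def)
  show ?case
    by (intro runs_intros; use threshold_insert[OF 5(2), of "line s k"] 5(3) assms(2) in
      \<open>auto simp: write_cell_def lines_upto_Suc line_def eqs\<close>)
qed (use assms in \<open>auto simp: write_cell_def threshold_def\<close>)

lemma runs_check_top:
  assumes "nats s vlines 0 \<le> M" "nats s vline 0 = j" "reals s rthr 0 = r"
  shows "runs n orc M check_top s (\<lambda>s'. 0 < nats s' vtop 0 \<longleftrightarrow>
    (\<forall>m\<in>lines s. r * fst m - snd m \<le> r * fst (line s j) - snd (line s j)))"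
  unfolding check_top_def
proof (intro runs_Seq runs_NAssign,
    rule runs_For[where I = "\<lambda>k s'. 0 < nats s' vtop 0 \<longleftrightarrow>
      (\<forall>m\<in>lines_upto s k. r * fst m - snd m \<le> r * fst (line s j) - snd (line s j))"], goal_cases)
  case (5 k s')
  have eqs: "reals s' = reals s" "nats s' vline = nats s vline"
    using 5(4) by (simp_all add: frame_def write_cell_def fun_eq_iff)
  show ?case
    by (intro runs_intros; use 5(2,3) assms(2,3) in
      \<open>auto simp: write_cell_def lines_upto_Suc line_def eqs\<close>)
qed (use assms in \<open>auto simp: write_cell_def\<close>)

text \<open>With \<open>k\<close> the number of all lines, this supplies the conditions on
  \<open>v\<close> and \<open>r\<close> in \<open>optimal_contract_from_lines\<close>.\<close>

definition best_line_inv :: "state \<Rightarrow> nat \<Rightarrow> real \<Rightarrow> real \<Rightarrow> bool" where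
  "best_line_inv s k v r \<longleftrightarrow> 0 \<le> v \<and>
     (v = 0 \<and> r = 0 \<or> (\<exists>l\<in>lines s. admissible (lines s) l r \<and> v = (1 - r) * fst l)) \<and>
     (\<forall>l\<in>lines_upto s k. \<forall>r. admissible (lines s) l r \<longrightarrow> (1 - r) * fst l \<le> v)"

text \<open>A line has only one threshold, so a single comparison settles all its admissible
  contracts.\<close>

lemma best_line_inv_step:
  assumes inv: "best_line_inv s k v r" and k: "k < nats s vlines 0"
    and thr: "threshold (lines s) (line s k) q"
  shows "best_line_inv s (Suc k)
    (if admissible (lines s) (line s k) q \<and> v < (1 - q) * fst (line s k)
      then (1 - q) * fst (line s k) else v)
    (if admissible (lines s) (line s k) q \<and> v < (1 - q) * fst (line s k) then q else r)"
proof -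
  have mem: "line s k \<in> lines s" using k by (simp add: lines_upto_def)
  have uniq: "r' = q" if "admissible (lines s) (line s k) r'" for r'
    using threshold_unique[OF thr] that by (auto simp: admissible_def)
  have upto: "l \<in> lines_upto s (Suc k) \<longleftrightarrow> l = line s k \<or> l \<in> lines_upto s k" for l
    by (simp add: lines_upto_Suc)
  show ?thesis
  proof (cases "admissible (lines s) (line s k) q \<and> v < (1 - q) * fst (line s k)")
    case True
    have "(1 - r') * fst l \<le> (1 - q) * fst (line s k)"
      if "l \<in> lines_upto s (Suc k)" "admissible (lines s) l r'" for l r'
      using that(1) unfolding upto
    proof
      assume "l = line s k"
      then show ?thesis using uniq that(2) by simp
    next
      assume "l \<in> lines_upto s k"
      then have "(1 - r') * fst l \<le> v" using inv that(2) unfolding best_line_inv_def by blast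
      then show ?thesis using True by linarith
    qed
    moreover have "0 \<le> (1 - q) * fst (line s k)" using True inv unfolding best_line_inv_def by linarith
    ultimately have "best_line_inv s (Suc k) ((1 - q) * fst (line s k)) q"
      using True mem unfolding best_line_inv_def by blast
    then show ?thesis unfolding if_P[OF True] .
  next
    case False
    have "(1 - r') * fst l \<le> v" if "l \<in> lines_upto s (Suc k)" "admissible (lines s) l r'" for l r'
      using that(1) unfolding upto
    proof
      assume l: "l = line s k"
      then have "r' = q" using uniq that(2) by simp
      then show ?thesis using False that(2) l by simp
    next
      assume "l \<in> lines_upto s k"
      then show ?thesis using inv that(2) unfolding best_line_inv_def by blast
    qed
    then have "best_line_inv s (Suc k) v r" using inv unfolding best_line_inv_def by blast
    then show ?thesis unfolding if_not_P[OF False] .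
  qed
qed

lemma runs_evaluate_lines:
  assumes M: "nats s vlines 0 \<le> M" and init: "reals s rvalue 0 = 0" "reals s rresult 0 = 0"
  shows "runs n orc M evaluate_lines s
    (\<lambda>s'. \<exists>v. best_line_inv s (nats s vlines 0) v (reals s' rresult 0))"
  unfolding evaluate_lines_def
proof (rule runs_For[where I = "\<lambda>k s'. best_line_inv s k (reals s' rvalue 0) (reals s' rresult 0)"],
    goal_cases)
  case (5 k s1)
  have k: "k < nats s vlines 0" using 5(1) by simp
  have eqs: "nats s1 vlines = nats s vlines" "lines s1 = lines s" "line s1 = line s"
    using 5(4) by (simp_all add: frame_def find_threshold_def check_top_def lines_upto_def line_def fun_eq_iff)
  show ?case
  proof (intro runs_Seq, rule runs_conseq[OF runs_find_threshold[of s1 M k]], goal_cases)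
    case (3 s2)
    have eqs2: "nats s2 vlines = nats s vlines" "nats s2 vline = nats s1 vline" "lines s2 = lines s" "line s2 = line s"
      "reals s2 rvalue = reals s1 rvalue" "reals s2 rresult = reals s1 rresult"
      using 3(2) eqs by (simp_all add: frame_def find_threshold_def lines_upto_def line_def fun_eq_iff)
    let ?q = "reals s2 rthr 0"
    have thr: "threshold (lines s) (line s k) ?q" using 3(1) eqs by simp
    show ?case
    proof (rule runs_Seq, rule runs_conseq[OF runs_check_top[of s2 M k ?q]], goal_cases)
      case (4 s3)
      have eqs3: "reals s3 = reals s2" "nats s3 vline = nats s2 vline"
        using 4(2) by (simp_all add: frame_def check_top_def fun_eq_iff)
      have top: "0 < nats s3 vtop 0 \<and> ?q \<le> 1 \<longleftrightarrow> admissible (lines s) (line s k) ?q"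
        using 4(1) thr eqs2 by (auto simp: admissible_def)
      have fst: "fst (line s k) = reals s2 rslope k" using eqs2(4) by (metis line_def fst_conv)
      show ?case
        by (intro runs_intros; use best_line_inv_step[OF 5(2) k thr] top 5(3) in
          \<open>auto simp: write_cell_def eqs3 eqs2 fst not_less split: if_splits\<close>)
    qed (use M eqs2 5(3) in auto)
  qed (use M eqs 5(3) in auto)
qed (use assms in \<open>auto simp: write_cell_def find_threshold_def check_top_def best_line_inv_def\<close>)

text \<open>The pairs tested so far are those lexicographically below \<open>(a, b)\<close>. The
  final disjunction prepares that of \<open>next_swap\<close>; the value \<open>n\<close> in both
  cells stands for no swap.\<close>

definition swap_inv ::
  "nat \<Rightarrow> (nat set \<Rightarrow> real) \<Rightarrow> (nat set \<Rightarrow> real) \<Rightarrow> nat set \<Rightarrow> nat \<Rightarrow> nat \<Rightarrow> state \<Rightarrow> bool" where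
  "swap_inv n f p S a b s \<longleftrightarrow>
     nats s vsize 0 = n \<and> support_upto n (nats s vwork) = S \<and> reals s rf 0 = f S \<and> reals s rp 0 = p S \<and>
     (\<forall>x\<in>S. \<forall>y\<in>{..<n} - S. (x < a \<or> x = a \<and> y < b) \<longrightarrow> f (insert y (S - {x})) < f S \<longrightarrow>
        swap_ratio f p S (insert y (S - {x})) \<le> reals s rbest 0) \<and>
     (reals s rbest 0 = 0 \<and> nats s vout 0 = n \<and> nats s vin 0 = n \<or>
      0 < reals s rbest 0 \<and> nats s vout 0 \<in> S \<and> nats s vin 0 \<in> {..<n} - S \<and>
      f (insert (nats s vin 0) (S - {nats s vout 0})) < f S \<and>
      swap_ratio f p S (insert (nats s vin 0) (S - {nats s vout 0})) = reals s rbest 0)"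

lemma lex_less_Suc: "x < a \<or> x = a \<and> y < Suc b \<longleftrightarrow> (x < a \<or> x = a \<and> y < b) \<or> x = a \<and> (y :: nat) = b"
  by auto

lemma swap_inv_skip:
  assumes inv: "swap_inv n f p S a b s"
    and new: "f (insert b (S - {a})) < f S \<Longrightarrow> swap_ratio f p S (insert b (S - {a})) \<le> reals s rbest 0"
    and s': "nats s' vsize 0 = n" "support_upto n (nats s' vwork) = S" "reals s' rf 0 = f S" "reals s' rp 0 = p S"
      "reals s' rbest 0 = reals s rbest 0" "nats s' vout 0 = nats s vout 0" "nats s' vin 0 = nats s vin 0"
  shows "swap_inv n f p S a (Suc b) s'"
  using inv new unfolding swap_inv_def s' lex_less_Suc by blast

lemma swap_inv_take:
  assumes inv: "swap_inv n f p S a b s" and ab: "a \<in> S" "b \<in> {..<n} - S"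
    and new: "f (insert b (S - {a})) < f S" "reals s rbest 0 < swap_ratio f p S (insert b (S - {a}))"
    and s': "nats s' vsize 0 = n" "support_upto n (nats s' vwork) = S" "reals s' rf 0 = f S" "reals s' rp 0 = p S"
      "reals s' rbest 0 = swap_ratio f p S (insert b (S - {a}))" "nats s' vout 0 = a" "nats s' vin 0 = b"
  shows "swap_inv n f p S a (Suc b) s'"
proof -
  have "swap_ratio f p S (insert y (S - {x})) \<le> swap_ratio f p S (insert b (S - {a}))"
    if xy: "x \<in> S" "y \<in> {..<n} - S" "f (insert y (S - {x})) < f S"
      and "(x < a \<or> x = a \<and> y < b) \<or> x = a \<and> y = b" for x y
    using that(4)
  proof
    assume "x < a \<or> x = a \<and> y < b"
    then have "swap_ratio f p S (insert y (S - {x})) \<le> reals s rbest 0"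
      using inv xy unfolding swap_inv_def by blast
    then show ?thesis using new(2) by linarith
  qed simp
  moreover have "0 < swap_ratio f p S (insert b (S - {a}))"
    using inv new(2) unfolding swap_inv_def by linarith
  ultimately show ?thesis using ab new(1) unfolding swap_inv_def s' lex_less_Suc by blast
qed

section \<open>Greedy steps, swaps and sweeps as executed\<close>

context spa_contract
begin

abbreviation "run \<equiv> runs n (input_oracle f g p)"

lemma runs_extend_base:
  assumes n: "nats s vsize 0 = n" "n \<le> M" and S: "support_upto n (nats s vbase) = S"
  shows "run M extend_base s (\<lambda>s'. S = {..<n} \<or> (\<exists>y\<in>{..<n} - S.
     support_upto n (nats s' vbase) = insert y S \<and>
     (\<forall>z\<in>{..<n} - S. f (insert z S) - p (insert z S) \<le> f (insert y S) - p (insert y S))))"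
  unfolding extend_base_def
proof (intro runs_Seq runs_NAssign,
    rule runs_For[where I = "\<lambda>k s'. support_upto n (nats s' vbase) = S \<and> nats s' vsize 0 = n \<and>
      nats s' vin 0 \<le> n \<and>
      (nats s' vin 0 < n \<longrightarrow> nats s' vin 0 \<notin> S \<and>
         reals s' rbest 0 = f (insert (nats s' vin 0) S) - p (insert (nats s' vin 0) S)) \<and>
      (\<forall>z<k. z \<notin> S \<longrightarrow> nats s' vin 0 < n \<and> f (insert z S) - p (insert z S) \<le> reals s' rbest 0)"],
    goal_cases)
  case (5 k s')
  then have k: "k < n" and T: "support_upto n (nats s' vbase) = S" "nats s' vsize 0 = n" "nats s' vy 0 = k"
    using n by (auto simp: write_cell_def)
  have kS: "k \<in> S \<longleftrightarrow> 0 < nats s' vbase k"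
    using mem_support_upto[OF k, of "nats s' vbase"] T by simp
  have restore: "k \<notin> S \<Longrightarrow> insert k S - {k} = S" by auto
  show ?case
    by (intro runs_intros; use 5(2) k T kS restore in
      \<open>auto simp: write_cell_def held_set_support_upto less_Suc_eq intro: order_trans\<close>)
next
  case (6 s')
  have SA: "S \<subseteq> {..<n}" using S support_upto_subset by blast
  show ?case
  proof (cases "nats s' vin 0 < n")
    case True
    then show ?thesis using 6(1) n
      by (intro runs_NAssign disjI2 bexI[of _ "nats s' vin 0"]) (auto simp: write_cell_def)
  next
    case False
    \<comment> \<open>Any element outside \<open>S\<close> would have produced a candidate by
      now.\<close>
    then have "S = {..<n}" using 6(1) n SA by (auto simp: write_cell_def)
    then show ?thesis by (intro runs_NAssign) simp
  qed
qed (use n S in \<open>auto simp: write_cell_def\<close>)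

lemma runs_try_swap:
  assumes inv: "swap_inv n f p S a b s" and ab: "nats s vx 0 = a" "nats s vy 0 = b" "a \<in> S" "b \<in> {..<n} - S"
  shows "run M try_swap s (swap_inv n f p S a (Suc b))"
proof -
  have an: "a < n" using inv ab(3) support_upto_subset by (auto simp: swap_inv_def)
  have bn: "b < n" using ab(4) by simp
  have restore: "insert a (insert b (S - {a}) - {b}) = S" using ab by auto
  have T: "nats s vsize 0 = n" "support_upto n (nats s vwork) = S" "reals s rf 0 = f S" "reals s rp 0 = p S"
    using inv by (simp_all add: swap_inv_def)
  show ?thesis
    unfolding try_swap_def
  proof ((rule runs_Seq, rule runs_NAssign runs_Query,
        simp add: write_cell_def held_set_support_upto T ab an bn)+, intro runs_intros, goal_cases)
    case 1
    then show ?case using an bn restore T ab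
      by (intro swap_inv_take[OF inv ab(3,4)])
        (simp_all add: write_cell_def held_set_support_upto swap_ratio_def)
  next
    case 2
    then show ?case using an bn restore T ab
      by (intro swap_inv_skip[OF inv])
        (simp_all add: write_cell_def held_set_support_upto swap_ratio_def not_less)
  qed
qed

lemma runs_swap_work:
  assumes n: "nats s vsize 0 = n" "n \<le> M" and S: "support_upto n (nats s vwork) = S"
  shows "run M swap_work s (\<lambda>s'. next_swap {..<n} f p S (support_upto n (nats s' vwork)))"
  unfolding swap_work_def
proof (intro runs_Seq runs_NAssign runs_RAssign runs_Query,
    rule runs_For[where I = "\<lambda>k. swap_inv n f p S k 0"], goal_cases)
  case 4
  show ?case using n S by (simp add: swap_inv_def write_cell_def held_set_support_upto)
next
  case (5 a s1)
  then have a: "a < n" using n by (simp add: write_cell_def)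
  have aS: "a \<in> S \<longleftrightarrow> 0 < nats s1 vwork a"
    using mem_support_upto[OF a, of "nats s1 vwork"] 5(2) by (simp add: swap_inv_def)
  show ?case
  proof (rule runs_Cond)
    assume "bval (NLess (Num 0) (NCell vwork (ncell vx))) s1"
    then have "a \<in> S" using aS 5(3) by simp
    have n1: "nats s1 vsize 0 = n" using 5(2) by (simp add: swap_inv_def)
    show "run M (For vy (ncell vsize) (Cond (NLess (Num 0) (NCell vwork (ncell vy))) Skip try_swap)) s1
      (\<lambda>s'. swap_inv n f p S (Suc a) 0 (s'\<lparr>nats := write_cell (nats s') vx 0 (Suc a)\<rparr>))"
    proof (rule runs_For[where I = "swap_inv n f p S a"], goal_cases)
      case 4
      show ?case using 5(2) by (simp add: swap_inv_def write_cell_def)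
    next
      case (5 b s2)
      then have b: "b < n" using n1 by simp
      have bS: "b \<in> S \<longleftrightarrow> 0 < nats s2 vwork b"
        using mem_support_upto[OF b, of "nats s2 vwork"] 5(2) by (simp add: swap_inv_def)
      have x: "nats s2 vx 0 = a" using 5(4) \<open>nats s1 vx 0 = a\<close> by (simp add: frame_def try_swap_def)
      show ?case
      proof (rule runs_Cond)
        assume "bval (NLess (Num 0) (NCell vwork (ncell vy))) s2"
        then have "b \<in> S" using bS 5(3) by simp
        then show "run M Skip s2
          (\<lambda>s'. swap_inv n f p S a (Suc b) (s'\<lparr>nats := write_cell (nats s') vy 0 (Suc b)\<rparr>))"
          using 5(2) by (intro runs_Skip) (auto simp: swap_inv_def write_cell_def lex_less_Suc)
      next
        assume "\<not> bval (NLess (Num 0) (NCell vwork (ncell vy))) s2"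
        then have "b \<in> {..<n} - S" using bS 5(3) b by simp
        from runs_try_swap[OF 5(2) x 5(3) \<open>a \<in> S\<close> this]
        show "run M try_swap s2
          (\<lambda>s'. swap_inv n f p S a (Suc b) (s'\<lparr>nats := write_cell (nats s') vy 0 (Suc b)\<rparr>))"
          by (rule runs_conseq) (auto simp: swap_inv_def write_cell_def)
      qed
    next
      case (6 s2)
      then have "swap_inv n f p S a n s2" using n1 by simp
      \<comment> \<open>Every \<open>y\<close> is below \<open>n\<close>, so the bounds
        \<open>(a, n)\<close> and \<open>(Suc a, 0)\<close> describe the same tested pairs.\<close>
      then show ?case by (auto simp: swap_inv_def write_cell_def less_Suc_eq)
    qed (use n1 n(2) in \<open>auto simp: try_swap_def\<close>)
  next
    assume "\<not> bval (NLess (Num 0) (NCell vwork (ncell vx))) s1"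
    then have "a \<notin> S" using aS 5(3) by simp
    then show "run M Skip s1
        (\<lambda>s'. swap_inv n f p S (Suc a) 0 (s'\<lparr>nats := write_cell (nats s') vx 0 (Suc a)\<rparr>))"
      using 5(2) by (intro runs_Skip) (auto simp: swap_inv_def write_cell_def less_Suc_eq)
  qed
next
  case (6 s1)
  then have inv: "swap_inv n f p S n 0 s1" using n by (simp add: write_cell_def)
  have SA: "S \<subseteq> {..<n}" using S support_upto_subset by blast
  let ?r = "reals s1 rbest 0" and ?x = "nats s1 vout 0" and ?y = "nats s1 vin 0"
  have W: "support_upto n (nats s1 vwork) = S" using inv by (simp add: swap_inv_def)
  have ratios: "swap_ratios_le {..<n} f p S ?r"
    using inv SA by (auto simp: swap_inv_def swap_ratios_le_def)
  have cases: "?r = 0 \<and> ?x = n \<and> ?y = n \<or> 0 < ?r \<and> ?x \<in> S \<and> ?y \<in> {..<n} - S \<and>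
      f (insert ?y (S - {?x})) < f S \<and> swap_ratio f p S (insert ?y (S - {?x})) = ?r"
    using inv by (simp add: swap_inv_def)
  then show ?case
  proof (elim disjE)
    assume r: "?r = 0 \<and> ?x = n \<and> ?y = n"
    \<comment> \<open>Both final writes hit position \<open>n\<close>, and
      \<open>support_upto_update\<close> turns each into the removal of \<open>n\<close>.\<close>
    have "S - {n} = S" using SA by auto
    then have "next_swap {..<n} f p S S" using ratios r by (auto simp: next_swap_def)
    then show ?case using r W \<open>S - {n} = S\<close>
      by (intro runs_intros) (simp add: write_cell_def)
  next
    assume r: "0 < ?r \<and> ?x \<in> S \<and> ?y \<in> {..<n} - S \<and>
      f (insert ?y (S - {?x})) < f S \<and> swap_ratio f p S (insert ?y (S - {?x})) = ?r"
    then have "next_swap {..<n} f p S (insert ?y (S - {?x}))"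
      using ratios unfolding next_swap_def by (intro exI[of _ ?r]) auto
    then show ?case using r W
      by (intro runs_intros) (simp add: write_cell_def)
  qed
qed (use n in \<open>auto simp: write_cell_def try_swap_def\<close>)

lemma runs_record_line:
  assumes "support_upto n (nats s vwork) = S"
  shows "run M record_line s (\<lambda>s'. lines s' = insert (f S, cost S) (lines s) \<and>
    nats s' vlines 0 = Suc (nats s vlines 0))"
  unfolding record_line_def
  by (intro runs_intros; use assms in
    \<open>auto simp: write_cell_def held_set_support_upto lines_upto_def line_def cost_def lessThan_Suc\<close>)

text \<open>\<open>s\<close> is the state before the sweep. The lower inclusion keeps earlier layers
  covered, the upper one keeps every line the line of a set.\<close>

definition sweep_state :: "state \<Rightarrow> nat \<Rightarrow> nat \<Rightarrow> state \<Rightarrow> bool" where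
  "sweep_state s i k s' \<longleftrightarrow> nats s' vsize 0 = n \<and>
     sweep_inv (lines s') i (support_upto n (nats s' vwork)) k \<and>
     nats s' vlines 0 = nats s vlines 0 + k \<and>
     lines s \<subseteq> lines s' \<and> lines s' \<subseteq> lines s \<union> (\<lambda>S. (f S, cost S)) ` Pow {..<n}"

lemma sweep_state_nats_update:
  "v \<notin> {vsize, vwork, vlines} \<Longrightarrow>
   sweep_state s i k (s'\<lparr>nats := write_cell (nats s') v j u\<rparr>) = sweep_state s i k s'"
  by (simp add: sweep_state_def write_cell_def lines_upto_def line_def)

lemma runs_sweep_round:
  assumes "sweep_state s i k s1" "n \<le> M"
  shows "run M (record_line ;; swap_work) s1 (sweep_state s i (Suc k))"
proof (rule runs_Seq, rule runs_conseq[OF runs_record_line[OF refl]], goal_cases)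
  case (1 s2)
  let ?S = "support_upto n (nats s1 vwork)"
  have fr: "nats s2 vwork = nats s1 vwork" "nats s2 vsize = nats s1 vsize"
    using 1(2) by (simp_all add: frame_def record_line_def)
  show ?case
  proof (rule runs_conseq[OF runs_swap_work[OF _ _ refl]], goal_cases)
    case (3 s3)
    have fr3: "lines s3 = lines s2" "nats s3 vlines = nats s2 vlines" "nats s3 vsize = nats s2 vsize"
      using 3(2) by (simp_all add: frame_def swap_work_def try_swap_def lines_upto_def line_def)
    have "sweep_inv (insert (f ?S, cost ?S) (lines s1)) i (support_upto n (nats s3 vwork)) (Suc k)"
      using assms(1) 3(1) fr by (intro sweep_inv_step[of _ _ ?S]) (auto simp: sweep_state_def)
    then show ?case
      using assms(1) 1(1) fr fr3 support_upto_subset[of n "nats s1 vwork"]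
      by (auto simp: sweep_state_def)
  qed (use fr assms in \<open>auto simp: sweep_state_def\<close>)
qed

lemma runs_sweep:
  assumes n: "nats s vsize 0 = n" "n + 1 \<le> M"
    and opt: "optimal_at 1 (support_upto n (nats s vwork))" "card (support_upto n (nats s vwork)) = i"
  shows "run M sweep s (sweep_state s i ((n + 1) * (n + 1)))"
  unfolding sweep_def
proof (rule runs_For[where I = "\<lambda>a. sweep_state s i (a * (n + 1))"], goal_cases)
  case 4
  show ?case using n sweep_inv_start[OF opt(1), of "lines s"] opt(2)
    by (simp add: sweep_state_nats_update) (simp add: sweep_state_def)
next
  case (5 a s1)
  have n1: "nats s1 vsize 0 = n" using 5(2) by (simp add: sweep_state_def)
  show ?case
  proof (rule runs_For[where I = "\<lambda>b. sweep_state s i (a * (n + 1) + b)"], goal_cases)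
    case 4
    show ?case using 5(2) by (simp add: sweep_state_nats_update)
  next
    case (5 b s2)
    have "n \<le> M" using n by simp
    from runs_sweep_round[OF 5(2) this] show ?case
      by (rule runs_conseq) (simp add: sweep_state_nats_update)
  next
    case (6 s2)
    then show ?case using n1 by (simp add: sweep_state_nats_update algebra_simps)
  qed (use n n1 in \<open>auto simp: record_line_def swap_work_def try_swap_def\<close>)
next
  case (6 s1)
  then show ?case using n by simp
qed (use n in \<open>auto simp: record_line_def swap_work_def try_swap_def\<close>)

text \<open>The guard \<open>i \<le> n\<close> allows for the exit at \<open>i = n + 1\<close>, a
  layer without sets. The exact number of lines later bounds the rounds of the evaluation
  loops.\<close>

definition layer_state :: "nat \<Rightarrow> state \<Rightarrow> bool" where
  "layer_state i s \<longleftrightarrow> nats s vsize 0 = n \<and>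
     (i \<le> n \<longrightarrow> optimal_at 1 (support_upto n (nats s vbase)) \<and> card (support_upto n (nats s vbase)) = i) \<and>
     nats s vlines 0 = i * ((n + 1) * (n + 1)) \<and>
     lines s \<subseteq> (\<lambda>S. (f S, cost S)) ` Pow {..<n} \<and>
     (\<forall>j<i. \<forall>\<beta>. 0 < \<beta> \<and> \<beta> \<le> 1 \<longrightarrow> covered (lines s) j \<beta>)"

lemma layer_state_nats_update:
  "v \<notin> {vsize, vbase, vlines} \<Longrightarrow>
   layer_state i (s\<lparr>nats := write_cell (nats s) v j u\<rparr>) = layer_state i s"
  by (simp add: layer_state_def write_cell_def lines_upto_def line_def)

lemma runs_copy_base:
  assumes "nats s vsize 0 = n" "n \<le> M"
  shows "run M (For vx (ncell vsize) (NAssign vwork (ncell vx) (NCell vbase (ncell vx)))) s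
    (\<lambda>s'. support_upto n (nats s' vwork) = support_upto n (nats s vbase))"
proof (rule runs_For[where I = "\<lambda>k s'. \<forall>i<k. nats s' vwork i = nats s vbase i"], goal_cases)
  case (5 k s')
  have "nats s' vbase = nats s vbase" using 5(4) by (simp add: frame_def)
  then show ?case
    by (intro runs_intros) (use 5(2,3) in \<open>auto simp: write_cell_def less_Suc_eq\<close>)
next
  case (6 s')
  then show ?case using assms by (auto simp: support_upto_def)
qed (use assms in auto)

lemma optimal_at_greedy:
  assumes "optimal_at 1 S" "y \<in> {..<n} - S"
    "\<And>z. z \<in> {..<n} - S \<Longrightarrow> f (insert z S) - p (insert z S) \<le> f (insert y S) - p (insert y S)"
  shows "optimal_at 1 (insert y S)"
  unfolding optimal_at_def
proof (rule greedy_extension_layer_optimal)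
  show "ultra {..<n} (\<lambda>S. 1 * f S - p S)" using f_ultra p_additive by (intro ultra_priced) auto
qed (use assms in \<open>auto simp: optimal_at_def\<close>)

lemma optimal_at_empty: "optimal_at \<beta> {}"
proof -
  have "T = {}" if "T \<subseteq> {..<n}" "card T = 0" for T
    using that finite_subset[of T "{..<n}"] by simp
  then show ?thesis by (auto simp: optimal_at_def layer_optimal_def)
qed

lemma runs_layer:
  assumes st: "layer_state i s" and i: "i \<le> n" and M: "n + 1 \<le> M"
  shows "run M (For vx (ncell vsize) (NAssign vwork (ncell vx) (NCell vbase (ncell vx))) ;;
    sweep ;; extend_base) s (layer_state (Suc i))"
proof (rule runs_Seq, rule runs_conseq[OF runs_copy_base], goal_cases)
  case (3 s1)
  let ?S = "support_upto n (nats s vbase)"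
  have S: "optimal_at 1 ?S" "card ?S = i" using st i by (auto simp: layer_state_def)
  have fr1: "nats s1 vsize = nats s vsize" "nats s1 vbase = nats s vbase" "nats s1 vlines = nats s vlines"
    "lines s1 = lines s"
    using 3(2) by (simp_all add: frame_def lines_upto_def line_def)
  show ?case
  proof (rule runs_Seq, rule runs_conseq[OF runs_sweep[of s1 M i]], goal_cases)
    case (5 s2)
    have fr2: "nats s2 vsize = nats s vsize" "nats s2 vbase = nats s vbase"
      using 5(2) fr1 by (simp_all add: frame_def sweep_def record_line_def swap_work_def try_swap_def)
    have inv: "sweep_inv (lines s2) i (support_upto n (nats s2 vwork)) ((n + 1) * (n + 1))"
      using 5(1) unfolding sweep_state_def by blast
    \<comment> \<open>The sweep has made more than \<open>n * n\<close> rounds, so its layer is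
      finished.\<close>
    have cov: "covered (lines s2) i \<beta>" if "0 < \<beta>" "\<beta> \<le> 1" for \<beta>
      by (rule sweep_inv_end[OF inv _ that]) simp
    show ?case
    proof (rule runs_conseq[OF runs_extend_base[OF _ _ refl]], goal_cases)
      case (3 s3)
      have fr3: "nats s3 vsize = nats s vsize" "nats s3 vlines = nats s2 vlines" "lines s3 = lines s2"
        using 3(2) fr2 by (simp_all add: frame_def extend_base_def lines_upto_def line_def)
      have next_base: "optimal_at 1 (support_upto n (nats s3 vbase)) \<and>
          card (support_upto n (nats s3 vbase)) = Suc i" if "Suc i \<le> n"
      proof -
        have "card ?S \<noteq> card {..<n}" using S(2) that by simp
        then have "?S \<noteq> {..<n}" by metis
        then obtain y where y: "y \<in> {..<n} - ?S" "support_upto n (nats s3 vbase) = insert y ?S"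
          "\<forall>z\<in>{..<n} - ?S. f (insert z ?S) - p (insert z ?S) \<le> f (insert y ?S) - p (insert y ?S)"
          using 3(1) unfolding fr2(2) by blast
        have "finite ?S" using support_upto_subset finite_subset by blast
        then show ?thesis using optimal_at_greedy[OF S(1) y(1)] y S(2) by simp
      qed
      have "covered (lines s3) j \<beta>" if "j < Suc i" "0 < \<beta> \<and> \<beta> \<le> 1" for j \<beta>
      proof (cases "j = i")
        case True
        then show ?thesis using cov that fr3 by simp
      next
        case False
        then have "j < i" using that(1) by simp
        then have "covered (lines s) j \<beta>" using st that(2) unfolding layer_state_def by blast
        moreover have "lines s \<subseteq> lines s3"
          using 5(1) unfolding sweep_state_def fr1(4) fr3(3) by blast
        ultimately show ?thesis by (rule covered_mono)
      qed
      moreover have "lines s3 \<subseteq> (\<lambda>S. (f S, cost S)) ` Pow {..<n}"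
        using st 5(1) unfolding layer_state_def sweep_state_def fr1(4) fr3(3) by blast
      moreover have "nats s3 vsize 0 = n" "nats s3 vlines 0 = Suc i * ((n + 1) * (n + 1))"
        using st 5(1) fr1(3) fr3(1,2) by (auto simp: layer_state_def sweep_state_def)
      ultimately show ?case using next_base unfolding layer_state_def by blast
    qed (use fr2 st M in \<open>auto simp: layer_state_def\<close>)
  qed (use fr1 st M S 3(1) in \<open>auto simp: layer_state_def\<close>)
qed (use st M in \<open>auto simp: layer_state_def\<close>)

lemma runs_record_all:
  assumes "n + 1 \<le> M"
  shows "run M record_all (initial_state n) (layer_state (n + 1))"
  unfolding record_all_def
proof (rule runs_For[where I = layer_state], goal_cases)
  case 4
  show ?case
    by (simp add: layer_state_nats_update)
      (simp add: layer_state_def initial_state_def write_cell_def support_upto_def optimal_at_empty)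
next
  case (5 i s)
  then have "i \<le> n" by (simp add: initial_state_def write_cell_def)
  from runs_layer[OF 5(2) this assms] show ?case
    by (rule runs_conseq) (simp add: layer_state_nats_update)
next
  case (6 s)
  then show ?case by (simp add: initial_state_def write_cell_def)
qed (use assms in \<open>auto simp: initial_state_def write_cell_def extend_base_def sweep_def record_line_def swap_work_def try_swap_def\<close>)

text \<open>The loop bound is the number of recorded lines, \<open>(n + 1) * (n + 1)\<close> for
  each of the \<open>n + 1\<close> layers; no single loop runs longer.\<close>

lemma runs_program:
  "run ((n + 1) * ((n + 1) * (n + 1))) program (initial_state n)
     (\<lambda>s. optimal_contract {..<n} f cost (result s))"
  unfolding program_def
proof (rule runs_Seq, rule runs_conseq[OF runs_record_all], goal_cases)
  case (2 s)
  have L: "lines_cover {..<n} f cost (lines s)"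
    using 2(1) by (intro covered_imp_lines_cover) (auto simp: layer_state_def)
  have fr: "reals s rvalue = reals (initial_state n) rvalue" "reals s rresult = reals (initial_state n) rresult"
    using 2(2) by (simp_all add: frame_def record_all_def extend_base_def sweep_def record_line_def
        swap_work_def try_swap_def)
  show ?case
  proof (rule runs_conseq[OF runs_evaluate_lines], goal_cases)
    case (4 s')
    then obtain v where v: "best_line_inv s (nats s vlines 0) v (reals s' rresult 0)" by blast
    show ?case
      unfolding result_def
      by (rule optimal_contract_from_lines[OF _ f_nonneg L, of v])
        (use v in \<open>auto simp: best_line_inv_def\<close>)
  qed (use 2(1) fr in \<open>simp_all add: layer_state_def initial_state_def\<close>)
qed simp

end

theorem theorem4p2:
  "\<exists>(prog :: com) (P :: nat poly).
     \<forall>(n :: nat) (A :: nat set) (f :: nat set \<Rightarrow> real) (g :: nat set \<Rightarrow> real)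
      (p :: nat set \<Rightarrow> real) (c :: nat set \<Rightarrow> real).
       A = {..<n} \<longrightarrow>
       nonneg_set_fun A f \<longrightarrow> monotone_normalized A f \<longrightarrow> ultra A f \<longrightarrow>
       nonneg_set_fun A g \<longrightarrow> mono_on (Pow A) g \<longrightarrow> symmetric_set_fun A g \<longrightarrow>
       nonneg_set_fun A p \<longrightarrow> additive_set_fun A p \<longrightarrow>
       c = (\<lambda>S. g S + p S) \<longrightarrow> monotone_normalized A c \<longrightarrow>
       (\<exists>t s. exec n (input_oracle f g p) prog (initial_state n) t s
          \<and> t \<le> poly P n
          \<and> optimal_contract A f c (result s))"
proof -
  obtain P :: "nat poly" where P: "\<And>M. time_bound M program = poly P M"
    using time_bound_poly by blast
  \<comment> \<open>\<open>[:1, 1:]\<close> is the polynomial of \<open>n + 1\<close>; its cube is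
    the loop bound substituted for \<open>M\<close>.\<close>
  let ?Q = "pcompose P ([:1, 1:] * ([:1, 1:] * [:1, 1:]))"
  show ?thesis
  proof (intro exI[of _ program] exI[of _ ?Q] allI impI, goal_cases)
    case (1 n A f g p c)
    interpret spa_contract n f g p using 1 by unfold_locales simp_all
    have "c = cost" using 1 by (simp add: cost_def fun_eq_iff)
    then show ?case
      using runs_program 1(1) unfolding runs_def P by (simp add: poly_pcompose algebra_simps)
  qed
qed

end
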